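(* Let $\mathcal{A}$ be a unital $C^*$-algebra, let $\mathcal{F}\subseteq\mathcal{A}$ be an ideal of finite type elements, let $a\in\mathcal{A}$ and let $p$ be a projection in $\mathcal{F}$. Then $a$ is a Fredholm type element in $\mathcal{A}$ with respect to the ideal $\mathcal{F}$ if and only if $(1-p)a(1-p)$ is a Fredholm type element in $(1-p)\mathcal{A}(1-p)$ with respect to the ideal $(1-p)\mathcal{F}(1-p)$, and in this case $\mathrm{index}\, a=\mathrm{index}\,(1-p)a(1-p)$.
   Context: Ideal of finite type elements: a subalgebra $\mathcal{F}\subseteq\mathcal{A}$ such that (i) $\mathcal{F}$ is a selfadjoint ideal: $ab,ba\in\mathcal{F}$ for all $a\in\mathcal{A}$, $b\in\mathcal{F}$, and $a\in\mathcal{F}$ implies $a^*\in\mathcal{F}$; (ii) there is an approximate unit $(p_\alpha)$ (in the norm topology) for $\mathcal{F}$ consisting of projections; (iii) if $p,q\in\mathcal{F}$ are projections, then there exists $v\in\mathcal{A}$ such that $vv^*=q$ and $v^*v\perp p$, i.e. $v^*v+p$ is a projection. For a projection $p\in\mathcal{F}$, $(1-p)\mathcal{F}(1-p)$ is again an ideal of finite type elements in the corner $C^*$-algebra $(1-p)\mathcal{A}(1-p)$, whose unit is $1-p$. For projections $p,q$: $p\sim q$ means there is $v\in\mathcal{A}$ with $vv^*=p$, $v^*v=q$. $S(\mathcal{F})=\mathrm{Proj}(\mathcal{F})/\!\sim$ is a commutative semigroup under $[p]+[q]=[p+q']$ where $q'\sim q$, $q'\perp p$; $K(\mathcal{F})$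 is its Grothendieck group. For $a\in\mathcal{A}$ and projections $p,q\in\mathcal{A}$, $a$ is invertible up to the pair $(p,q)$ if, with $a'=(1-q)a(1-p)$, there is $b\in\mathcal{A}$ with $b=(1-p)b(1-q)$, $a'b=1-q$, $ba'=1-p$. The element $a$ is of Fredholm type with respect to $\mathcal{F}$ if it is invertible up to $(p,q)$ for some projections $p,q\in\mathcal{F}$; its index is $\mathrm{index}\,a=[p]-[q]\in K(\mathcal{F})$ (known to be independent of the choice of $(p,q)$). The same definitions are used for $(1-p)\mathcal{A}(1-p)$ with ideal $(1-p)\mathcal{F}(1-p)$; the index of $(1-p)a(1-p)$ is regarded as an element of $K(\mathcal{F})$ via the map induced by the inclusion $(1-p)\mathcal{F}(1-p)\subseteq\mathcal{F}$. *)

theory Defs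
  imports "HOL-Analysis.Analysis" "HOL-Algebra.Group"
begin

section \<open>Unital C*-algebras\<close>

text \<open>
  The class is built on \<^class>\<open>real_normed_algebra\<close> and \<^class>\<open>monoid_mult\<close> rather than on
  \<^class>\<open>real_normed_algebra_1\<close>, so that the zero algebra is not excluded; if the unit is nonzero,
  then it has norm 1 by the C*-identity.
\<close>

class unital_cstar_algebra = real_normed_algebra + banach + monoid_mult +
  fixes cscale :: "complex \<Rightarrow> 'a \<Rightarrow> 'a"
    and star :: "'a \<Rightarrow> 'a"
  assumes cscale_add_right: "cscale c (x + y) = cscale c x + cscale c y"
    and cscale_add_left: "cscale (c + d) x = cscale c x + cscale d x"
    and cscale_cscale: "cscale c (cscale d x) = cscale (c * d) x"
    and cscale_of_real: "cscale (complex_of_real r) x = r *\<^sub>R x"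
    and mult_cscale_left: "cscale c x * y = cscale c (x * y)"
    and mult_cscale_right: "x * cscale c y = cscale c (x * y)"
    and norm_cscale: "norm (cscale c x) = cmod c * norm x"
    and star_star: "star (star x) = x"
    and star_add: "star (x + y) = star x + star y"
    and star_cscale: "star (cscale c x) = cscale (cnj c) (star x)"
    and star_mult: "star (x * y) = star y * star x"
    and norm_star_mult_self: "norm (star x * x) = (norm x)\<^sup>2"


section \<open>Projections and ideals of finite type elements\<close>

text \<open>
  In everything that follows, \<open>A\<close> is the underlying set of a C*-algebra contained in the ambient
  algebra and \<open>e\<close> is its unit. The ambient algebra itself is the case \<open>A = UNIV\<close>, \<open>e = 1\<close>;
  the corner algebra of a projection \<open>p\<close> is the case \<open>A = corner (1 - p) UNIV\<close>, \<open>e = 1 - p\<close>.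
\<close>

definition corner :: "'a::unital_cstar_algebra \<Rightarrow> 'a set \<Rightarrow> 'a set" where
  "corner e X = (\<lambda>x. e * x * e) ` X"

definition is_projection :: "'a::unital_cstar_algebra \<Rightarrow> bool" where
  "is_projection p \<longleftrightarrow> p * p = p \<and> star p = p"

definition Proj :: "'a::unital_cstar_algebra set \<Rightarrow> 'a set" where
  "Proj X = {p \<in> X. is_projection p}"

definition proj_perp :: "'a::unital_cstar_algebra \<Rightarrow> 'a \<Rightarrow> bool" where
  "proj_perp p q \<longleftrightarrow> is_projection p \<and> is_projection q \<and> is_projection (p + q)"

definition is_subalgebra :: "'a::unital_cstar_algebra set \<Rightarrow> 'a set \<Rightarrow> bool" where
  "is_subalgebra F A \<longleftrightarrow> F \<subseteq> A \<and> 0 \<in> F \<and>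
     (\<forall>x\<in>F. \<forall>y\<in>F. x + y \<in> F \<and> x * y \<in> F) \<and> (\<forall>c. \<forall>x\<in>F. cscale c x \<in> F)"

text \<open>
  A net is represented by the proper filter generated by the images of its tails; conversely every
  proper filter arises from a net in this way. Hence the quantification over filters below is the
  quantification over all nets of elements of \<open>F\<close>, with no restriction on the index set.
\<close>

definition approximate_unit :: "'a::unital_cstar_algebra set \<Rightarrow> 'a filter \<Rightarrow> bool" where
  "approximate_unit F \<Phi> \<longleftrightarrow> \<Phi> \<noteq> bot \<and> (\<forall>\<^sub>F u in \<Phi>. u \<in> F) \<and>
     (\<forall>x\<in>F. ((\<lambda>u. u * x) \<longlongrightarrow> x) \<Phi> \<and> ((\<lambda>u. x * u) \<longlongrightarrow> x) \<Phi>)"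

definition finite_type_ideal :: "'a::unital_cstar_algebra set \<Rightarrow> 'a set \<Rightarrow> bool" where
  "finite_type_ideal A F \<longleftrightarrow>
     is_subalgebra F A \<and>
     (\<forall>a\<in>A. \<forall>b\<in>F. a * b \<in> F \<and> b * a \<in> F) \<and> (\<forall>a\<in>F. star a \<in> F) \<and>
     (\<exists>\<Phi>. approximate_unit F \<Phi> \<and> (\<forall>\<^sub>F u in \<Phi>. is_projection u)) \<and>
     (\<forall>p\<in>Proj F. \<forall>q\<in>Proj F. \<exists>v\<in>A. v * star v = q \<and> proj_perp (star v * v) p)"


section \<open>The semigroup of equivalence classes of projections\<close>

definition mvn_rel :: "'a::unital_cstar_algebra set \<Rightarrow> 'a set \<Rightarrow> ('a \<times> 'a) set" where
  "mvn_rel A F = {(p, q). p \<in> Proj F \<and> q \<in> Proj F \<and> (\<exists>v\<in>A. v * star v = p \<and> star v * v = q)}"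

abbreviation mvn_class :: "'a::unital_cstar_algebra set \<Rightarrow> 'a set \<Rightarrow> 'a \<Rightarrow> 'a set" where
  "mvn_class A F p \<equiv> mvn_rel A F `` {p}"

text \<open>
  The sum of two classes is the class of \<open>p + q\<close> for orthogonal representatives \<open>p\<close>, \<open>q\<close>. All
  such choices give the same class, so that the union below is that class.
\<close>

definition proj_semigroup :: "'a::unital_cstar_algebra set \<Rightarrow> 'a set \<Rightarrow> 'a set monoid" where
  "proj_semigroup A F =
     \<lparr>carrier = Proj F // mvn_rel A F,
      mult = (\<lambda>X Y. \<Union>{mvn_class A F (p + q) |p q. p \<in> X \<and> q \<in> Y \<and> proj_perp p q}),
      one = mvn_class A F 0\<rparr>"


section \<open>The Grothendieck group of a commutative monoid\<close>

definition groth_rel :: "('s, 'm) monoid_scheme \<Rightarrow> (('s \<times> 's) \<times> ('s \<times> 's)) set" where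
  "groth_rel M = {((x, y), (x', y')). x \<in> carrier M \<and> y \<in> carrier M \<and> x' \<in> carrier M \<and> y' \<in> carrier M \<and>
     (\<exists>z\<in>carrier M. x \<otimes>\<^bsub>M\<^esub> y' \<otimes>\<^bsub>M\<^esub> z = x' \<otimes>\<^bsub>M\<^esub> y \<otimes>\<^bsub>M\<^esub> z)}"

definition groth_group :: "('s, 'm) monoid_scheme \<Rightarrow> ('s \<times> 's) set monoid" where
  "groth_group M =
     \<lparr>carrier = (carrier M \<times> carrier M) // groth_rel M,
      mult = (\<lambda>X Y. \<Union>{groth_rel M `` {(x \<otimes>\<^bsub>M\<^esub> x', y \<otimes>\<^bsub>M\<^esub> y')} |x y x' y'. (x, y) \<in> X \<and> (x', y') \<in> Y}),
      one = groth_rel M `` {(\<one>\<^bsub>M\<^esub>, \<one>\<^bsub>M\<^esub>)}\<rparr>"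

definition groth_embed :: "('s, 'm) monoid_scheme \<Rightarrow> 's \<Rightarrow> ('s \<times> 's) set" where
  "groth_embed M x = groth_rel M `` {(x, \<one>\<^bsub>M\<^esub>)}"

text \<open>The homomorphism of Grothendieck groups induced by a homomorphism \<open>h\<close> with values in \<open>N\<close>.\<close>

definition groth_map :: "('t, 'n) monoid_scheme \<Rightarrow> ('s \<Rightarrow> 't) \<Rightarrow> ('s \<times> 's) set \<Rightarrow> ('t \<times> 't) set" where
  "groth_map N h X = groth_rel N `` (map_prod h h ` X)"

definition K_group :: "'a::unital_cstar_algebra set \<Rightarrow> 'a set \<Rightarrow> ('a set \<times> 'a set) set monoid" where
  "K_group A F = groth_group (proj_semigroup A F)"

definition K_class :: "'a::unital_cstar_algebra set \<Rightarrow> 'a set \<Rightarrow> 'a \<Rightarrow> ('a set \<times> 'a set) set" where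
  "K_class A F p = groth_embed (proj_semigroup A F) (mvn_class A F p)"

text \<open>
  For a smaller algebra with a smaller ideal, the inclusion of its ideal into \<open>F\<close> sends the class
  \<open>X\<close> of a projection \<open>p\<close> to the class of \<open>p\<close> relative to \<open>A\<close> and \<open>F\<close>, which is the saturation
  of \<open>X\<close> under the equivalence of projections in the larger algebra.
\<close>

definition K_inclusion ::
    "'a::unital_cstar_algebra set \<Rightarrow> 'a set \<Rightarrow> ('a set \<times> 'a set) set \<Rightarrow> ('a set \<times> 'a set) set" where
  "K_inclusion A F = groth_map (proj_semigroup A F) (\<lambda>X. mvn_rel A F `` X)"


section \<open>Fredholm type elements and their index\<close>

definition invertible_up_to ::
    "'a::unital_cstar_algebra set \<Rightarrow> 'a \<Rightarrow> 'a \<Rightarrow> 'a \<Rightarrow> 'a \<Rightarrow> bool" where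
  "invertible_up_to A e a p q \<longleftrightarrow>
     (let a' = (e - q) * a * (e - p)
      in \<exists>b\<in>A. b = (e - p) * b * (e - q) \<and> a' * b = e - q \<and> b * a' = e - p)"

definition fredholm_type :: "'a::unital_cstar_algebra set \<Rightarrow> 'a \<Rightarrow> 'a set \<Rightarrow> 'a \<Rightarrow> bool" where
  "fredholm_type A e F a \<longleftrightarrow> (\<exists>p\<in>Proj F. \<exists>q\<in>Proj F. invertible_up_to A e a p q)"

definition fredholm_index ::
    "'a::unital_cstar_algebra set \<Rightarrow> 'a \<Rightarrow> 'a set \<Rightarrow> 'a \<Rightarrow> ('a set \<times> 'a set) set" where
  "fredholm_index A e F a =
     (THE k. \<exists>p\<in>Proj F. \<exists>q\<in>Proj F. invertible_up_to A e a p q \<and>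
        k = K_class A F p \<otimes>\<^bsub>K_group A F\<^esub> inv\<^bsub>K_group A F\<^esub> K_class A F q)"


section \<open>The definitions are meaningful\<close>

text \<open>
  For a commutative monoid, \<^const>\<open>groth_group\<close> is an abelian group in which the class of a pair is
  the difference of its components. For an ideal of finite type elements, \<^const>\<open>proj_semigroup\<close> is
  a commutative monoid.
\<close>

context comm_monoid begin

lemma groth_rel_iff:
  "((x, y), (x', y')) \<in> groth_rel G \<longleftrightarrow> x \<in> carrier G \<and> y \<in> carrier G \<and> x' \<in> carrier G \<and> y' \<in> carrier G \<and>
     (\<exists>z\<in>carrier G. x \<otimes> y' \<otimes> z = x' \<otimes> y \<otimes> z)"
  by (simp add: groth_rel_def)

lemma groth_rel_equiv: "equiv (carrier G \<times> carrier G) (groth_rel G)"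
proof (rule equivI)
  show "groth_rel G \<subseteq> (carrier G \<times> carrier G) \<times> (carrier G \<times> carrier G)"
    by (auto simp: groth_rel_def)
  show "refl_on (carrier G \<times> carrier G) (groth_rel G)"
    by (auto simp: refl_on_def groth_rel_def)
  show "sym (groth_rel G)"
  proof (rule symI, clarsimp simp: groth_rel_iff)
    fix x y x' y' z assume "x \<otimes> y' \<otimes> z = x' \<otimes> y \<otimes> z" "z \<in> carrier G"
    then show "\<exists>z\<in>carrier G. x' \<otimes> y \<otimes> z = x \<otimes> y' \<otimes> z" by metis
  qed
  show "trans (groth_rel G)"
  proof (rule transI, clarsimp simp: groth_rel_iff)
    fix x y x' y' x'' y'' z w
    assume c: "x \<in> carrier G" "y \<in> carrier G" "x' \<in> carrier G" "y' \<in> carrier G"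
      "x'' \<in> carrier G" "y'' \<in> carrier G" "z \<in> carrier G" "w \<in> carrier G"
    assume 1: "x \<otimes> y' \<otimes> z = x' \<otimes> y \<otimes> z" and 2: "x' \<otimes> y'' \<otimes> w = x'' \<otimes> y' \<otimes> w"
    have "x \<otimes> y'' \<otimes> (y' \<otimes> z \<otimes> w) = (x \<otimes> y' \<otimes> z) \<otimes> (y'' \<otimes> w)"
      using c by (simp add: m_ac)
    also have "\<dots> = (x' \<otimes> y'' \<otimes> w) \<otimes> (y \<otimes> z)" unfolding 1 using c by (simp add: m_ac)
    also have "\<dots> = x'' \<otimes> y \<otimes> (y' \<otimes> z \<otimes> w)" unfolding 2 using c by (simp add: m_ac)
    finally show "\<exists>z\<in>carrier G. x \<otimes> y'' \<otimes> z = x'' \<otimes> y \<otimes> z" using c by blast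
  qed
qed

lemma groth_rel_mult:
  assumes "((x, y), (x', y')) \<in> groth_rel G" "((u, v), (u', v')) \<in> groth_rel G"
  shows "((x \<otimes> u, y \<otimes> v), (x' \<otimes> u', y' \<otimes> v')) \<in> groth_rel G"
proof -
  from assms obtain z w where c: "x \<in> carrier G" "y \<in> carrier G" "x' \<in> carrier G" "y' \<in> carrier G"
      "u \<in> carrier G" "v \<in> carrier G" "u' \<in> carrier G" "v' \<in> carrier G" "z \<in> carrier G" "w \<in> carrier G"
    and 1: "x \<otimes> y' \<otimes> z = x' \<otimes> y \<otimes> z" and 2: "u \<otimes> v' \<otimes> w = u' \<otimes> v \<otimes> w"
    by (auto simp: groth_rel_iff)
  have "x \<otimes> u \<otimes> (y' \<otimes> v') \<otimes> (z \<otimes> w) = (x \<otimes> y' \<otimes> z) \<otimes> (u \<otimes> v' \<otimes> w)"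
    using c by (simp add: m_ac)
  also have "\<dots> = x' \<otimes> u' \<otimes> (y \<otimes> v) \<otimes> (z \<otimes> w)" unfolding 1 2 using c by (simp add: m_ac)
  finally show ?thesis using c by (auto simp: groth_rel_iff)
qed

lemma groth_mult:
  assumes "x \<in> carrier G" "y \<in> carrier G" "u \<in> carrier G" "v \<in> carrier G"
  shows "groth_rel G `` {(x, y)} \<otimes>\<^bsub>groth_group G\<^esub> groth_rel G `` {(u, v)} = groth_rel G `` {(x \<otimes> u, y \<otimes> v)}"
proof -
  have "groth_rel G `` {(x' \<otimes> u', y' \<otimes> v')} = groth_rel G `` {(x \<otimes> u, y \<otimes> v)}"
    if "((x, y), (x', y')) \<in> groth_rel G" "((u, v), (u', v')) \<in> groth_rel G" for x' y' u' v'
    using equiv_class_eq[OF groth_rel_equiv groth_rel_mult[OF that]] by simp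
  moreover have "((x, y), (x, y)) \<in> groth_rel G" "((u, v), (u, v)) \<in> groth_rel G"
    using assms by (auto simp: groth_rel_iff)
  ultimately have "{groth_rel G `` {(x' \<otimes> u', y' \<otimes> v')} |x' y' u' v'. ((x, y), (x', y')) \<in> groth_rel G \<and> ((u, v), (u', v')) \<in> groth_rel G}
    = {groth_rel G `` {(x \<otimes> u, y \<otimes> v)}}" by blast
  then show ?thesis unfolding groth_group_def by simp
qed

lemma groth_carrierE:
  assumes "X \<in> carrier (groth_group G)"
  obtains x y where "x \<in> carrier G" "y \<in> carrier G" "X = groth_rel G `` {(x, y)}"
  using assms by (auto simp: groth_group_def elim!: quotientE)

lemma groth_class_carrier:
  "x \<in> carrier G \<Longrightarrow> y \<in> carrier G \<Longrightarrow> groth_rel G `` {(x, y)} \<in> carrier (groth_group G)"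
  by (auto simp: groth_group_def quotient_def)

lemma groth_one: "\<one>\<^bsub>groth_group G\<^esub> = groth_rel G `` {(\<one>, \<one>)}"
  by (simp add: groth_group_def)

lemma groth_diag: "x \<in> carrier G \<Longrightarrow> groth_rel G `` {(x, x)} = groth_rel G `` {(\<one>, \<one>)}"
  by (rule equiv_class_eq[OF groth_rel_equiv]) (auto simp: groth_rel_iff)

lemma groth_comm_group: "comm_group (groth_group G)"
proof (rule comm_groupI)
  fix X assume "X \<in> carrier (groth_group G)"
  then obtain x y where "x \<in> carrier G" "y \<in> carrier G" "X = groth_rel G `` {(x, y)}"
    by (rule groth_carrierE)
  then show "\<exists>Y\<in>carrier (groth_group G). Y \<otimes>\<^bsub>groth_group G\<^esub> X = \<one>\<^bsub>groth_group G\<^esub>"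
    using groth_diag[of "x \<otimes> y"] by (intro bexI[of _ "groth_rel G `` {(y, x)}"])
       (simp_all add: groth_mult groth_class_carrier groth_one m_comm)
qed (auto elim!: groth_carrierE simp: groth_mult groth_class_carrier groth_one m_ac)

lemma groth_embed_diff:
  assumes "x \<in> carrier G" "y \<in> carrier G"
  shows "groth_embed G x \<otimes>\<^bsub>groth_group G\<^esub> inv\<^bsub>groth_group G\<^esub> groth_embed G y = groth_rel G `` {(x, y)}"
proof -
  interpret K: comm_group "groth_group G" by (rule groth_comm_group)
  have "inv\<^bsub>groth_group G\<^esub> groth_embed G y = groth_rel G `` {(\<one>, y)}"
    using assms groth_diag[of y] by (intro K.inv_equality)
      (simp_all add: groth_embed_def groth_mult groth_class_carrier groth_one)
  then show ?thesis using assms by (simp add: groth_embed_def groth_mult)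
qed

end

lemma groth_map_class:
  assumes "comm_monoid M" "comm_monoid N" "h \<in> hom M N" "x \<in> carrier M" "y \<in> carrier M"
  shows "groth_map N h (groth_rel M `` {(x, y)}) = groth_rel N `` {(h x, h y)}"
proof -
  interpret M: comm_monoid M by fact
  interpret N: comm_monoid N by fact
  have *: "((h x, h y), (h u, h v)) \<in> groth_rel N" if "((x, y), (u, v)) \<in> groth_rel M" for u v
  proof -
    from that obtain z where z: "u \<in> carrier M" "v \<in> carrier M" "z \<in> carrier M"
      "x \<otimes>\<^bsub>M\<^esub> v \<otimes>\<^bsub>M\<^esub> z = u \<otimes>\<^bsub>M\<^esub> y \<otimes>\<^bsub>M\<^esub> z" by (auto simp: M.groth_rel_iff)
    then have "h (x \<otimes>\<^bsub>M\<^esub> v \<otimes>\<^bsub>M\<^esub> z) = h (u \<otimes>\<^bsub>M\<^esub> y \<otimes>\<^bsub>M\<^esub> z)" by simp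
    then have "h x \<otimes>\<^bsub>N\<^esub> h v \<otimes>\<^bsub>N\<^esub> h z = h u \<otimes>\<^bsub>N\<^esub> h y \<otimes>\<^bsub>N\<^esub> h z"
      using assms(4,5) z(1-3) by (simp add: hom_mult[OF assms(3)])
    then show ?thesis using assms z by (auto simp: N.groth_rel_iff hom_in_carrier[OF assms(3)] intro!: bexI[of _ "h z"])
  qed
  have "((x, y), (x, y)) \<in> groth_rel M" using assms by (auto simp: M.groth_rel_iff)
  then have "groth_map N h (groth_rel M `` {(x, y)}) \<supseteq> groth_rel N `` {(h x, h y)}"
    unfolding groth_map_def by (force simp: map_prod_def)
  moreover have "groth_map N h (groth_rel M `` {(x, y)}) \<subseteq> groth_rel N `` {(h x, h y)}"
  proof
    fix w assume "w \<in> groth_map N h (groth_rel M `` {(x, y)})"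
    then obtain u v where "((x, y), (u, v)) \<in> groth_rel M" "((h u, h v), w) \<in> groth_rel N"
      by (auto simp: groth_map_def)
    with * show "w \<in> groth_rel N `` {(h x, h y)}"
      using N.groth_rel_equiv by (meson Image_singleton_iff equivE transE)
  qed
  ultimately show ?thesis by blast
qed

lemma star_zero: "star (0::'a::unital_cstar_algebra) = 0"
  using star_add[of "0::'a" 0] by simp

lemma star_diff: "star (x - y :: 'a::unital_cstar_algebra) = star x - star y"
  using star_add[of "x - y" y] by (simp add: algebra_simps)

lemma star_mult_self_eq_0: "star x * x = 0 \<Longrightarrow> x = (0::'a::unital_cstar_algebra)"
  using norm_star_mult_self[of x] by simp

lemma proj_perp_iff:
  fixes p q :: "'a::unital_cstar_algebra"
  assumes "is_projection p" "is_projection q"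
  shows "proj_perp p q \<longleftrightarrow> p * q = 0"
proof
  assume "proj_perp p q"
  then have "(p + q) * (p + q) = p + q" by (simp add: proj_perp_def is_projection_def)
  then have s: "p * q + q * p = 0" using assms by (simp add: is_projection_def algebra_simps)
  have "p * (p * q + q * p) * p = p * q * p + p * q * p"
    using assms by (simp add: is_projection_def distrib_left distrib_right mult.assoc) (metis mult.assoc)
  then have "2 *\<^sub>R (p * q * p) = 0" using s by (simp add: scaleR_2)
  then have 0: "p * q * p = 0" by simp
  have "p * (p * q + q * p) = p * q + p * q * p"
    using assms by (simp add: is_projection_def distrib_left mult.assoc[symmetric])
  then show "p * q = 0" using s 0 by simp
next
  assume 0: "p * q = 0"
  have "star (p * q) = q * p" using assms by (simp add: star_mult is_projection_def)
  then have "q * p = 0" using 0 by (simp add: star_zero)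
  then show "proj_perp p q"
    using assms 0 by (simp add: proj_perp_def is_projection_def star_add algebra_simps)
qed

lemma proj_perp_sym: "proj_perp p q \<Longrightarrow> proj_perp q p"
  by (simp add: proj_perp_def add.commute)

lemma mvn_absorb:
  fixes v :: "'a::unital_cstar_algebra"
  assumes "v * star v = p" "is_projection p"
  shows "p * v = v"
proof -
  let ?x = "star (v - p * v)"
  have "star ?x * ?x = v * star v - v * star v * p - p * (v * star v) + p * (v * star v) * p"
    using assms(2) by (simp add: star_star star_diff star_mult is_projection_def algebra_simps)
  also have "\<dots> = 0" using assms by (simp add: is_projection_def)
  finally have "?x = 0" by (rule star_mult_self_eq_0)
  then show ?thesis by (metis star_star star_zero eq_iff_diff_eq_0)
qed

locale finite_type =
  fixes A F :: "'a::unital_cstar_algebra set"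
  assumes ideal: "finite_type_ideal A F"
    and A_add: "x \<in> A \<Longrightarrow> y \<in> A \<Longrightarrow> x + y \<in> A"
    and A_mult: "x \<in> A \<Longrightarrow> y \<in> A \<Longrightarrow> x * y \<in> A"
    and A_star: "x \<in> A \<Longrightarrow> star x \<in> A"
begin

abbreviation "R \<equiv> mvn_rel A F"

lemma F_A: "F \<subseteq> A" and zero_F: "0 \<in> F"
  and F_add: "x \<in> F \<Longrightarrow> y \<in> F \<Longrightarrow> x + y \<in> F"
  and F_ideal: "a \<in> A \<Longrightarrow> x \<in> F \<Longrightarrow> a * x \<in> F" "a \<in> A \<Longrightarrow> x \<in> F \<Longrightarrow> x * a \<in> F"
  using ideal by (auto simp: finite_type_ideal_def is_subalgebra_def)

lemma mvn_equiv: "equiv (Proj F) R"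
proof (rule equivI)
  show "R \<subseteq> Proj F \<times> Proj F" by (auto simp: mvn_rel_def)
  show "refl_on (Proj F) R"
    unfolding refl_on_def mvn_rel_def using F_A by (auto simp: Proj_def is_projection_def intro!: bexI)
  show "sym R"
  proof (rule symI)
    fix p q assume "(p, q) \<in> R"
    then obtain v where "p \<in> Proj F" "q \<in> Proj F" "v \<in> A" "v * star v = p" "star v * v = q"
      by (auto simp: mvn_rel_def)
    then show "(q, p) \<in> R" using A_star[of v] by (auto simp: mvn_rel_def star_star intro!: bexI[of _ "star v"])
  qed
  show "trans R"
  proof (rule transI)
    fix p q r assume "(p, q) \<in> R" "(q, r) \<in> R"
    then obtain v w where *: "p \<in> Proj F" "q \<in> Proj F" "r \<in> Proj F" "v \<in> A" "w \<in> A"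
      "v * star v = p" "star v * v = q" "w * star w = q" "star w * w = r"
      by (auto simp: mvn_rel_def)
    have "star v = q * star v" using mvn_absorb[of "star v" q] * by (simp add: star_star Proj_def)
    then have "v * w * star (v * w) = p" using * by (simp add: star_mult mult.assoc) (metis mult.assoc)
    moreover have "w = q * w" using mvn_absorb[of w q] * by (simp add: Proj_def)
    then have "star (v * w) * (v * w) = r" using * by (simp add: star_mult mult.assoc) (metis mult.assoc)
    ultimately show "(p, r) \<in> R" using * A_mult by (auto simp: mvn_rel_def)
  qed
qed

lemma Proj_add: "p \<in> Proj F \<Longrightarrow> q \<in> Proj F \<Longrightarrow> proj_perp p q \<Longrightarrow> p + q \<in> Proj F"
  using F_add by (auto simp: Proj_def proj_perp_def)

lemma mvn_add:
  assumes "(p, p') \<in> R" "(q, q') \<in> R" "proj_perp p q" "proj_perp p' q'"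
  shows "(p + q, p' + q') \<in> R"
proof -
  from assms obtain v w where *: "p \<in> Proj F" "q \<in> Proj F" "p' \<in> Proj F" "q' \<in> Proj F" "v \<in> A" "w \<in> A"
    "v * star v = p" "star v * v = p'" "w * star w = q" "star w * w = q'" by (auto simp: mvn_rel_def)
  then have pr: "is_projection p" "is_projection q" "is_projection p'" "is_projection q'" by (auto simp: Proj_def)
  have 0: "p * q = 0" "p' * q' = 0" "q * p = 0" "q' * p' = 0"
    using assms(3,4) proj_perp_iff[OF pr(1,2)] proj_perp_iff[OF pr(3,4)]
      proj_perp_iff[OF pr(2,1)] proj_perp_iff[OF pr(4,3)] proj_perp_sym by auto
  have a: "p * v = v" "q * w = w" "p' * star v = star v" "q' * star w = star w"
    using mvn_absorb[of v p] mvn_absorb[of w q] mvn_absorb[of "star v" p'] mvn_absorb[of "star w" q'] * pr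
    by (auto simp: star_star)
  have b: "v * p' = v" "w * q' = w" "star v * p = star v" "star w * q = star w"
    using a pr by (metis is_projection_def star_mult star_star)+
  have z: "v * star w = 0" "w * star v = 0" "star v * w = 0" "star w * v = 0"
    using a b 0 by (metis mult.assoc mult_zero_left mult_zero_right)+
  have "(v + w) * star (v + w) = p + q" "star (v + w) * (v + w) = p' + q'"
    using z * by (simp_all add: star_add algebra_simps)
  then show ?thesis using A_add[of v w] * Proj_add assms(3,4) by (auto simp: mvn_rel_def)
qed

lemma S_mult:
  assumes "p \<in> Proj F" "q \<in> Proj F" "proj_perp p q"
  shows "R `` {p} \<otimes>\<^bsub>proj_semigroup A F\<^esub> R `` {q} = R `` {p + q}"
proof -
  have "R `` {p' + q'} = R `` {p + q}" if "(p, p') \<in> R" "(q, q') \<in> R" "proj_perp p' q'" for p' q'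
    using equiv_class_eq[OF mvn_equiv mvn_add[OF that(1,2) assms(3) that(3)]] by simp
  moreover have "(p, p) \<in> R" "(q, q) \<in> R" using assms mvn_equiv by (auto elim!: equivE dest: refl_onD)
  ultimately have "{R `` {p' + q'} |p' q'. (p, p') \<in> R \<and> (q, q') \<in> R \<and> proj_perp p' q'} = {R `` {p + q}}"
    using assms(3) by blast
  then show ?thesis unfolding proj_semigroup_def by simp
qed

lemma perp_rep:
  assumes "p \<in> Proj F" "q \<in> Proj F"
  obtains q' where "q' \<in> Proj F" "proj_perp p q'" "R `` {q} = R `` {q'}"
proof -
  from ideal assms obtain v where v: "v \<in> A" "v * star v = q" "proj_perp (star v * v) p"
    unfolding finite_type_ideal_def by blast
  have "v = q * v" using mvn_absorb[of v q] v assms by (simp add: Proj_def)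
  then have "star v * v \<in> F" using assms v A_star F_ideal by (metis (no_types, lifting) Proj_def mem_Collect_eq)
  then have "star v * v \<in> Proj F" using v by (auto simp: Proj_def proj_perp_def)
  moreover from this v assms have "(q, star v * v) \<in> R" by (auto simp: mvn_rel_def)
  then have "R `` {q} = R `` {star v * v}" by (rule equiv_class_eq[OF mvn_equiv])
  ultimately show thesis using v proj_perp_sym that by blast
qed

lemma S_carrierE:
  assumes "X \<in> carrier (proj_semigroup A F)"
  obtains p where "p \<in> Proj F" "X = R `` {p}"
  using assms by (auto simp: proj_semigroup_def elim!: quotientE)

lemma S_class: "p \<in> Proj F \<Longrightarrow> R `` {p} \<in> carrier (proj_semigroup A F)"
  by (auto simp: proj_semigroup_def quotientI)

lemma proj_semigroup_comm_monoid: "comm_monoid (proj_semigroup A F)"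
proof (rule comm_monoidI)
  have zP: "0 \<in> Proj F" using zero_F by (simp add: Proj_def is_projection_def star_zero)
  show "\<one>\<^bsub>proj_semigroup A F\<^esub> \<in> carrier (proj_semigroup A F)"
    using S_class[OF zP] by (simp add: proj_semigroup_def)
  fix X assume "X \<in> carrier (proj_semigroup A F)"
  then obtain p where p: "p \<in> Proj F" "X = R `` {p}" by (rule S_carrierE)
  have "proj_perp 0 p" using p by (simp add: proj_perp_def Proj_def is_projection_def star_zero)
  then show "\<one>\<^bsub>proj_semigroup A F\<^esub> \<otimes>\<^bsub>proj_semigroup A F\<^esub> X = X"
    using S_mult[OF zP p(1)] p by (simp add: proj_semigroup_def)
  fix Y assume "Y \<in> carrier (proj_semigroup A F)"
  then obtain q0 where q0: "q0 \<in> Proj F" "Y = R `` {q0}" by (rule S_carrierE)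
  obtain q where q: "q \<in> Proj F" "proj_perp p q" "Y = R `` {q}" using perp_rep[OF p(1) q0(1)] q0 by metis
  show "X \<otimes>\<^bsub>proj_semigroup A F\<^esub> Y \<in> carrier (proj_semigroup A F)"
    using S_mult S_class Proj_add p q by simp
  show "X \<otimes>\<^bsub>proj_semigroup A F\<^esub> Y = Y \<otimes>\<^bsub>proj_semigroup A F\<^esub> X"
    using S_mult[OF p(1) q(1,2)] S_mult[OF q(1) p(1) proj_perp_sym[OF q(2)]] p q by (simp add: add.commute)
  fix Z assume "Z \<in> carrier (proj_semigroup A F)"
  then obtain r0 where r0: "r0 \<in> Proj F" "Z = R `` {r0}" by (rule S_carrierE)
  have pq: "p + q \<in> Proj F" using Proj_add p q by simp
  obtain r where r: "r \<in> Proj F" "proj_perp (p + q) r" "Z = R `` {r}" using perp_rep[OF pq r0(1)] r0 by metis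
  have pr: "is_projection p" "is_projection q" "is_projection r" "is_projection (p + q)"
    using p q r pq by (auto simp: Proj_def)
  have pq0: "p * q = 0" "q * p = 0"
    using proj_perp_iff[OF pr(1,2)] proj_perp_iff[OF pr(2,1)] q(2) proj_perp_sym by auto
  have "(p + q) * r = 0" using proj_perp_iff[OF pr(4,3)] r by simp
  then have "p * ((p + q) * r) = 0" "q * ((p + q) * r) = 0" by simp_all
  then have "p * r = 0" "q * r = 0"
    using pq0 pr by (simp_all add: is_projection_def mult.assoc[symmetric] distrib_left)
  then have qr: "proj_perp q r" and "p * (q + r) = 0"
    using proj_perp_iff[OF pr(2,3)] pq0 by (simp_all add: distrib_left)
  then have "proj_perp p (q + r)" using proj_perp_iff pr by (metis proj_perp_def)
  then show "X \<otimes>\<^bsub>proj_semigroup A F\<^esub> Y \<otimes>\<^bsub>proj_semigroup A F\<^esub> Z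
    = X \<otimes>\<^bsub>proj_semigroup A F\<^esub> (Y \<otimes>\<^bsub>proj_semigroup A F\<^esub> Z)"
    using S_mult p q r pq qr Proj_add by (simp add: add.assoc)
qed

end

end

theory Submission
  imports Defs
begin

text \<open>
  Write \<open>s\<close> for the given projection. A pair \<open>(p, q)\<close> of projections in the corner of \<open>1 - s\<close> works for
  \<open>(1 - s) a (1 - s)\<close> if and only if \<open>(s + p, s + q)\<close> works for \<open>a\<close>, with the same inverse. It thus
  suffices to replace any pair for \<open>a\<close> by one dominating \<open>s\<close> in both entries, without changing the index.
  A projection \<open>u \<ge> s\<close> in \<open>F\<close> that almost dominates \<open>p\<close> exists by perturbing the approximate unit; then
  \<open>p\<close> may be moved slightly to a subprojection of \<open>u\<close>, and enlarging it to \<open>u\<close> enlarges \<open>q\<close> by a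
  projection equivalent to the one added to \<open>p\<close>. Doing this for \<open>a\<close> and then for \<open>a\<^sup>*\<close> dominates both
  entries. The same device brings two pairs for \<open>a\<close> to a common first entry, whence the index is
  well defined. Finally every class in \<open>S(F)\<close> has a representative orthogonal to \<open>s\<close>, so that the
  semigroup of the corner is isomorphic to \<open>S(F)\<close>.
\<close>

section \<open>Binomial series and square roots\<close>

text \<open>Lets an equation for a product rewrite inside a right-nested product; used mostly as
  \<open>[THEN mult_assoc_eq]\<close>.\<close>

lemma mult_assoc_eq: "x * y = w \<Longrightarrow> x * (y * z) = w * z" for x :: "'a::semigroup_mult"
  by (simp add: mult.assoc[symmetric])

lemma star_one: "star (1::'a::unital_cstar_algebra) = 1"
  by (metis mult.left_neutral mult.right_neutral star_mult star_star)

lemma star_scaleR: "star (r *\<^sub>R x) = r *\<^sub>R star (x::'a::unital_cstar_algebra)"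
  by (metis cscale_of_real star_cscale complex_cnj_complex_of_real)

text \<open>The C*-identity makes \<open>norm 1\<close> equal to its own square. The value 0 occurs
  in the zero algebra, which the class admits.\<close>

lemma norm_one_le: "norm (1::'a::unital_cstar_algebra) \<le> 1"
proof -
  have "norm (1::'a) = norm (1::'a) * norm (1::'a)"
    using norm_star_mult_self[of "1::'a"] by (simp add: star_one power2_eq_square)
  then show ?thesis by (metis mult_cancel_left1 le_numeral_extra(4) zero_le_one)
qed

lemma norm_star: "norm (star x) = norm (x::'a::unital_cstar_algebra)"
proof -
  have le: "norm x \<le> norm (star x)" for x :: 'a
  proof (cases "x = 0")
    case False
    have "norm x * norm x \<le> norm (star x) * norm x"
      using norm_mult_ineq[of "star x" x] norm_star_mult_self[of x] by (simp add: power2_eq_square)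
    with False show ?thesis by simp
  qed simp
  from le[of x] le[of "star x"] show ?thesis by (simp add: star_star)
qed

lemma norm_projection_le:
  fixes p :: "'a::unital_cstar_algebra"
  assumes "is_projection p"
  shows "norm p \<le> 1"
proof -
  have "norm p = norm p * norm p"
    using norm_star_mult_self[of p] assms by (simp add: is_projection_def power2_eq_square)
  then show ?thesis by (metis mult_cancel_left1 le_numeral_extra(4) norm_zero norm_eq_zero zero_le_one)
qed

lemma norm_power_le: "norm (x ^ n) \<le> norm (x::'a::unital_cstar_algebra) ^ n"
proof (induction n)
  case (Suc n)
  have "norm (x * x ^ n) \<le> norm x * norm (x ^ n)" by (rule norm_mult_ineq)
  also have "\<dots> \<le> norm x * norm x ^ n" using Suc by (intro mult_left_mono) auto
  finally show ?case by simp
qed (simp add: norm_one_le)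

lemma bounded_linear_star: "bounded_linear (star :: 'a::unital_cstar_algebra \<Rightarrow> 'a)"
  by (rule bounded_linear_intro[of _ 1]) (simp_all add: star_add star_scaleR norm_star)


section \<open>Real powers of 1 - y\<close>

text \<open>The power series of (1 - y)^\<alpha>, used for \<open>norm y < 1\<close>. The exponents
  -1, 1/2 and -1/2 do the work of a functional calculus.\<close>

definition binomial_series :: "real \<Rightarrow> 'a::unital_cstar_algebra \<Rightarrow> 'a" where
  "binomial_series \<alpha> y = (\<Sum>n. ((-1) ^ n * (\<alpha> gchoose n)) *\<^sub>R y ^ n)"

lemma summable_norm_binomial_series:
  fixes y :: "'a::unital_cstar_algebra"
  assumes "norm y < 1"
  shows "summable (\<lambda>n. norm (((-1) ^ n * (\<alpha> gchoose n)) *\<^sub>R y ^ n))"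
proof (rule summable_comparison_test)
  have "ereal (norm (norm y)) < conv_radius (\<lambda>n. \<alpha> gchoose n)"
    using assms by (simp add: conv_radius_gchoose)
  from abs_summable_in_conv_radius[OF this]
  show "summable (\<lambda>n. norm ((\<alpha> gchoose n) * norm y ^ n))" .
  show "\<exists>N. \<forall>n\<ge>N. norm (norm (((-1) ^ n * (\<alpha> gchoose n)) *\<^sub>R y ^ n)) \<le> norm ((\<alpha> gchoose n) * norm y ^ n)"
    by (auto simp: abs_mult norm_power_le intro!: mult_left_mono)
qed

lemma binomial_series_sums:
  fixes y :: "'a::unital_cstar_algebra"
  assumes "norm y < 1"
  shows "(\<lambda>n. ((-1) ^ n * (\<alpha> gchoose n)) *\<^sub>R y ^ n) sums binomial_series \<alpha> y"
  unfolding binomial_series_def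
  by (rule summable_sums[OF summable_norm_cancel[OF summable_norm_binomial_series[OF assms]]])

text \<open>The exponent law for powers of 1 - y: the coefficients of the Cauchy product are
  Vandermonde convolutions.\<close>

lemma binomial_series_mult:
  fixes y :: "'a::unital_cstar_algebra"
  assumes "norm y < 1"
  shows "binomial_series \<alpha> y * binomial_series \<beta> y = binomial_series (\<alpha> + \<beta>) y"
proof -
  let ?f = "\<lambda>\<gamma> n. ((-1) ^ n * (\<gamma> gchoose n)) *\<^sub>R y ^ n"
  have "(\<Sum>i\<le>n. ?f \<alpha> i * ?f \<beta> (n - i)) = ?f (\<alpha> + \<beta>) n" for n
  proof -
    have "(\<Sum>i\<le>n. ?f \<alpha> i * ?f \<beta> (n - i)) = (\<Sum>i\<le>n. ((-1) ^ n * ((\<alpha> gchoose i) * (\<beta> gchoose (n - i)))) *\<^sub>R y ^ n)"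
    proof (rule sum.cong[OF refl])
      fix i assume "i \<in> {..n}"
      then have "(-1::real) ^ i * (-1) ^ (n - i) = (-1) ^ n" "y ^ i * y ^ (n - i) = y ^ n"
        by (simp_all add: power_add[symmetric])
      then show "?f \<alpha> i * ?f \<beta> (n - i) = ((-1) ^ n * ((\<alpha> gchoose i) * (\<beta> gchoose (n - i)))) *\<^sub>R y ^ n"
        by (simp add: algebra_simps)
    qed
    also have "\<dots> = ((-1) ^ n * (\<Sum>i\<le>n. (\<alpha> gchoose i) * (\<beta> gchoose (n - i)))) *\<^sub>R y ^ n"
      by (simp add: scaleR_left.sum sum_distrib_left)
    finally show ?thesis by (simp only: gbinomial_Vandermonde[unfolded atLeast0AtMost])
  qed
  then show ?thesis
    using Cauchy_product_sums[OF summable_norm_binomial_series[OF assms, of \<alpha>] summable_norm_binomial_series[OF assms, of \<beta>]]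
      binomial_series_sums[OF assms, of "\<alpha> + \<beta>"] unfolding binomial_series_def
    by (simp add: sums_iff)
qed

lemma binomial_series_0: "binomial_series 0 y = 1"
proof -
  have "(\<lambda>n. ((-1) ^ n * ((0::real) gchoose n)) *\<^sub>R y ^ n) sums (\<Sum>n\<in>{0}. ((-1) ^ n * ((0::real) gchoose n)) *\<^sub>R y ^ n)"
    by (rule sums_finite) (auto simp: gbinomial_0_left)
  then show ?thesis unfolding binomial_series_def by (simp add: sums_iff)
qed

lemma binomial_series_1: "binomial_series 1 y = 1 - y"
proof -
  have z: "(1::real) gchoose n = 0" if "n \<notin> {0, 1}" for n
    using that binomial_gbinomial[of 1 n, where 'a = real] by (simp add: binomial_eq_0)
  have "(\<lambda>n. ((-1) ^ n * ((1::real) gchoose n)) *\<^sub>R y ^ n) sums (\<Sum>n\<in>{0,1}. ((-1) ^ n * ((1::real) gchoose n)) *\<^sub>R y ^ n)"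
    by (rule sums_finite) (auto simp: z)
  then show ?thesis unfolding binomial_series_def by (simp add: sums_iff)
qed

lemma binomial_series_commute:
  fixes y z :: "'a::unital_cstar_algebra"
  assumes "norm y < 1" "z * y = y * z"
  shows "z * binomial_series \<alpha> y = binomial_series \<alpha> y * z"
proof -
  have "z * y ^ n = y ^ n * z" for n
    using assms(2) by (induction n) (simp_all, metis mult.assoc)
  then show ?thesis
    using sums_mult[OF binomial_series_sums[OF assms(1)], of z \<alpha>]
      sums_mult2[OF binomial_series_sums[OF assms(1)], of \<alpha> z]
    by (simp add: sums_unique2)
qed

lemma star_binomial_series:
  fixes y :: "'a::unital_cstar_algebra"
  assumes "norm y < 1" "star y = y"
  shows "star (binomial_series \<alpha> y) = binomial_series \<alpha> y"
proof -
  have "star (y ^ n) = y ^ n" for n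
    using assms(2) by (induction n) (simp_all add: star_one star_mult power_commutes)
  then show ?thesis
    using bounded_linear.sums[OF bounded_linear_star binomial_series_sums[OF assms(1), of \<alpha>]]
      binomial_series_sums[OF assms(1), of \<alpha>]
    by (simp add: star_scaleR sums_unique2)
qed

text \<open>Exponent -1 gives the geometric series; the norm bound follows from n = 1 + n k.\<close>

lemma neumann_inverse:
  fixes k :: "'a::unital_cstar_algebra"
  assumes "norm k < 1"
  obtains n where "n * (1 - k) = 1" "(1 - k) * n = 1" "\<And>z. z * k = k * z \<Longrightarrow> z * n = n * z"
    "star k = k \<Longrightarrow> star n = n" "norm n \<le> 1 / (1 - norm k)"
proof -
  let ?n = "binomial_series (-1) k"
  have l: "?n * (1 - k) = 1"
    using binomial_series_mult[OF assms, of "-1" 1] by (simp add: binomial_series_0 binomial_series_1)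
  moreover have r: "(1 - k) * ?n = 1"
    using binomial_series_mult[OF assms, of 1 "-1"] by (simp add: binomial_series_0 binomial_series_1)
  moreover have "norm ?n \<le> 1 / (1 - norm k)"
  proof -
    have "?n = 1 + ?n * k" using l by (simp add: algebra_simps)
    then have "norm ?n \<le> norm (1::'a) + norm (?n * k)" by (metis norm_triangle_ineq)
    also have "\<dots> \<le> 1 + norm ?n * norm k" using norm_one_le norm_mult_ineq by (intro add_mono) auto
    finally show ?thesis using assms by (simp add: field_simps)
  qed
  ultimately show thesis using that[of ?n] binomial_series_commute[OF assms] star_binomial_series[OF assms] by metis
qed

section \<open>Square roots and inverse square roots\<close>

text \<open>The root is d (1 - (h/d)^2)^(1/2). The C*-identity turns \<open>norm (h * h)\<close>
  into the square of \<open>norm h\<close>, so the series converges.\<close>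

lemma square_root_complement:
  fixes h :: "'a::unital_cstar_algebra"
  assumes "star h = h" "norm h < d"
  obtains s where "star s = s" "s * s = d\<^sup>2 *\<^sub>R 1 - h * h" "\<And>z. z * (h * h) = h * h * z \<Longrightarrow> z * s = s * z"
proof -
  have d: "d > 0" using assms(2) norm_ge_zero[of h] by linarith
  let ?y = "(1 / d\<^sup>2) *\<^sub>R (h * h)"
  have "norm (h * h) = (norm h)\<^sup>2" using norm_star_mult_self[of h] assms by simp
  also have "\<dots> < d\<^sup>2" using assms(2) by (simp add: power_strict_mono)
  finally have y: "norm ?y < 1" using d by simp
  let ?s = "d *\<^sub>R binomial_series (1/2) ?y"
  show thesis
  proof (rule that)
    show "star ?s = ?s"
      using star_binomial_series[OF y] assms by (simp add: star_scaleR star_mult)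
    have "?s * ?s = d\<^sup>2 *\<^sub>R (1 - ?y)"
      using binomial_series_mult[OF y, of "1/2" "1/2"] by (simp add: binomial_series_1 power2_eq_square)
    then show "?s * ?s = d\<^sup>2 *\<^sub>R 1 - h * h" using d by (simp add: scaleR_diff_right)
    show "z * ?s = ?s * z" if "z * (h * h) = h * h * z" for z
      using binomial_series_commute[OF y, of z] that by simp
  qed
qed

text \<open>If \<open>h\<^sup>2 + s\<^sup>2 = d\<^sup>2\<close>, then \<open>h + i s\<close> is \<open>d\<close> times a unitary, so its imaginary part \<open>s\<close> has
  norm at most \<open>d\<close>. This replaces the spectral mapping theorem.\<close>

lemma norm_square_complement_le:
  fixes h :: "'a::unital_cstar_algebra"
  assumes "star h = h" "norm h < d"
  shows "norm (d\<^sup>2 *\<^sub>R 1 - h * h) \<le> d\<^sup>2"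
proof -
  have d: "d > 0" using assms(2) norm_ge_zero[of h] by linarith
  obtain s where s: "star s = s" "s * s = d\<^sup>2 *\<^sub>R 1 - h * h" "\<And>z. z * (h * h) = h * h * z \<Longrightarrow> z * s = s * z"
    using square_root_complement[OF assms] by blast
  have hs: "h * s = s * h" by (rule s(3)) (simp add: mult.assoc)
  define u where "u = h + cscale \<i> s"
  have i: "cscale (- \<i>) x = - cscale \<i> x" for x :: 'a
  proof -
    have "cscale (\<i> + - \<i>) x = 0" using cscale_of_real[of 0 x] by simp
    then show ?thesis using minus_unique unfolding cscale_add_left by metis
  qed
  have ii: "cscale \<i> (cscale \<i> x) = - x" for x :: 'a
    using cscale_of_real[of "-1" x] by (simp add: cscale_cscale)
  have cd: "cscale c (x - y) = cscale c x - cscale c y" for c and x y :: 'a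
    using cscale_add_right[of c "x - y" y] by (simp add: algebra_simps)
  have su: "star u = h - cscale \<i> s" by (simp add: u_def star_add star_cscale assms(1) s(1) i)
  have "star u * u = h * h + s * s"
    unfolding su unfolding u_def
    by (simp add: distrib_left distrib_right left_diff_distrib right_diff_distrib mult_cscale_left mult_cscale_right cscale_add_right cd hs ii)
  then have "(norm u)\<^sup>2 = norm (d\<^sup>2 *\<^sub>R (1::'a))" using norm_star_mult_self[of u] s(2) by simp
  also have "\<dots> \<le> d\<^sup>2" using norm_one_le[where 'a='a] by (simp add: mult_left_le)
  finally have nu: "norm u \<le> d" by (rule power2_le_imp_le) (use d in simp)
  have "u - star u = cscale (\<i> + \<i>) s"
    unfolding su unfolding u_def cscale_add_left by simp
  moreover have "cmod (\<i> + \<i>) = 2" by (metis mult_2 norm_ii norm_mult norm_numeral mult.right_neutral)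
  ultimately have "2 * norm s = norm (u - star u)" by (simp only: norm_cscale)
  also have "\<dots> \<le> norm u + norm u" using norm_triangle_ineq4[of u "star u"] by (simp add: norm_star)
  finally have "norm s \<le> d" using nu by simp
  then have "norm (s * s) \<le> d * d" using d
    by (intro order_trans[OF norm_mult_ineq] mult_mono) auto
  then show ?thesis using s(2) by (simp add: power2_eq_square)
qed

text \<open>For d > \<open>norm k\<close> write 1 + k^2 = (1 + d^2)(1 - y). The norm estimate just
  proved gives \<open>norm y\<close> at most d^2 / (1 + d^2) < 1, so exponent -1/2 applies even when
  k is large.\<close>

lemma inverse_square_root_one_plus_square:
  fixes k :: "'a::unital_cstar_algebra"
  assumes "star k = k"
  obtains s where "star s = s" "s * s * (1 + k * k) = 1" "\<And>z. z * (k * k) = k * k * z \<Longrightarrow> z * s = s * z"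
proof -
  define d where "d = norm k + 1"
  have d: "norm k < d" "1 + d\<^sup>2 > 0" by (auto simp: d_def add_pos_nonneg)
  define y where "y = (1 / (1 + d\<^sup>2)) *\<^sub>R (d\<^sup>2 *\<^sub>R 1 - k * k)"
  have "norm (d\<^sup>2 *\<^sub>R 1 - k * k) < 1 + d\<^sup>2" using norm_square_complement_le[OF assms d(1)] by simp
  then have y: "norm y < 1" using d by (simp add: y_def)
  have "(1 + d\<^sup>2) *\<^sub>R (1 - y) = (1 + d\<^sup>2) *\<^sub>R 1 - (d\<^sup>2 *\<^sub>R 1 - k * k)"
    using d by (simp add: y_def scaleR_diff_right)
  then have 1: "(1 + d\<^sup>2) *\<^sub>R (1 - y) = 1 + k * k" by (simp add: scaleR_left_distrib)
  let ?s = "(1 / sqrt (1 + d\<^sup>2)) *\<^sub>R binomial_series (-1/2) y"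
  show thesis
  proof (rule that)
    show "star ?s = ?s"
      using star_binomial_series[OF y] assms by (simp add: star_scaleR star_mult y_def star_diff star_one)
    have ss: "?s * ?s = (1 / (1 + d\<^sup>2)) *\<^sub>R binomial_series (-1) y"
      using binomial_series_mult[OF y, of "-1/2" "-1/2"] d by simp
    have "binomial_series (-1) y * (1 - y) = 1"
      using binomial_series_mult[OF y, of "-1" 1] by (simp add: binomial_series_0 binomial_series_1)
    then show "?s * ?s * (1 + k * k) = 1" unfolding ss 1[symmetric] using d by simp
    show "z * ?s = ?s * z" if "z * (k * k) = k * k * z" for z
    proof -
      have "z * y = y * z" using that by (simp add: y_def algebra_simps)
      then show ?thesis using binomial_series_commute[OF y, of z] by simp
    qed
  qed
qed

text \<open>Invertibility bounds h^2 from below: if c > \<open>norm g\<close> and m^2 = c^2 - g^2,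
  then (m h)^2 = c^2 h^2 - 1. Thus c^2 h^2 is 1 + k^2 with the self-adjoint k = m h.\<close>

lemma inverse_square_root_square:
  fixes h g :: "'a::unital_cstar_algebra"
  assumes "star h = h" "h * g = 1" "g * h = 1"
  obtains s where "star s = s" "s * s * (h * h) = 1" "\<And>z. z * (h * h) = h * h * z \<Longrightarrow> z * s = s * z"
proof -
  have "star g * h = 1" using assms by (metis star_mult star_one)
  then have g: "star g = g" using assms by (metis mult.assoc mult.left_neutral mult.right_neutral)
  define c where "c = norm g + 1"
  have c: "norm g < c" "c > 0" by (auto simp: c_def add_nonneg_pos)
  obtain m where m: "star m = m" "m * m = c\<^sup>2 *\<^sub>R 1 - g * g" "\<And>z. z * (g * g) = g * g * z \<Longrightarrow> z * m = m * z"
    using square_root_complement[OF g c(1)] by blast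
  note hg = assms(2,3) assms(2,3)[THEN mult_assoc_eq]
  have hm: "h * m = m * h" by (rule m(3)) (simp add: mult.assoc hg)
  have "m * h * (m * h) = m * m * (h * h)" using hm by (metis mult.assoc)
  also have "\<dots> = c\<^sup>2 *\<^sub>R (h * h) - 1" unfolding m(2) by (simp add: algebra_simps hg)
  finally have k: "m * h * (m * h) = c\<^sup>2 *\<^sub>R (h * h) - 1" .
  obtain s where s: "star s = s" "s * s * (1 + m * h * (m * h)) = 1"
    "\<And>z. z * (m * h * (m * h)) = m * h * (m * h) * z \<Longrightarrow> z * s = s * z"
    using inverse_square_root_one_plus_square[of "m * h"] assms m hm by (metis star_mult)
  show thesis
  proof (rule that[of "c *\<^sub>R s"])
    show "star (c *\<^sub>R s) = c *\<^sub>R s" by (simp add: star_scaleR s(1))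
    show "c *\<^sub>R s * c *\<^sub>R s * (h * h) = 1"
      using s(2) unfolding k by (simp add: power2_eq_square)
    show "z * c *\<^sub>R s = c *\<^sub>R s * z" if "z * (h * h) = h * h * z" for z
      using s(3)[of z] that unfolding k by (simp add: algebra_simps)
  qed
qed


section \<open>Projections and invertibility up to a pair\<close>

lemma is_projectionD:
  assumes "is_projection p"
  shows "p * p = p" "star p = p" "p * (p * x) = p * x"
  using assms by (simp_all add: is_projection_def mult.assoc[symmetric])

lemma is_projection_complement: "is_projection p \<Longrightarrow> is_projection (1 - p)"
  by (simp add: is_projection_def star_diff star_one algebra_simps)

lemma projection_le_sym:
  assumes "is_projection p" "is_projection u"
  shows "u * p = p \<longleftrightarrow> p * u = p"
  using assms by (metis is_projectionD(2) star_mult)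

lemma projection_zero_sym:
  assumes "is_projection p" "is_projection u"
  shows "u * p = 0 \<longleftrightarrow> p * u = 0"
  using assms by (metis is_projectionD(2) star_mult star_zero)

lemma is_projection_diff:
  assumes "is_projection p" "is_projection u" "u * p = p"
  shows "is_projection (u - p)"
  using assms projection_le_sym[OF assms(1,2)] by (simp add: is_projection_def star_diff algebra_simps)

section \<open>Algebraic equivalence and range projections\<close>

text \<open>Equivalence of idempotents in the sense of rings: x and y are mutually inverse between p
  and q, but y need not be the adjoint of x. Inverses of Fredholm type elements yield equivalences
  of this kind.\<close>

definition alg_equiv :: "'a::unital_cstar_algebra \<Rightarrow> 'a \<Rightarrow> bool" where
  "alg_equiv p q \<longleftrightarrow> (\<exists>x y. q * x = x \<and> x * p = x \<and> p * y = y \<and> y * q = y \<and> x * y = q \<and> y * x = p)"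

text \<open>The self-adjoint unitary \<open>H |H|\<^sup>-\<^sup>1\<close> for \<open>H = x + x\<^sup>* + (1 - p - q)\<close> interchanges \<open>p\<close> and \<open>q\<close>.
  Orthogonality makes \<open>x\<^sup>* x + x x\<^sup>*\<close> the square of a self-adjoint element, so that no general
  positivity result for \<open>x\<^sup>* x\<close> is needed.\<close>

lemma alg_equiv_orthogonal_imp_mvn:
  fixes p q :: "'a::unital_cstar_algebra"
  assumes "is_projection p" "is_projection q" "p * q = 0" "alg_equiv p q"
  obtains v where "v * star v = p" "star v * v = q"
proof -
  obtain x y where xy: "q * x = x" "x * p = x" "p * y = y" "y * q = y" "x * y = q" "y * x = p"
    using assms(4) by (auto simp: alg_equiv_def)
  have qp: "q * p = 0" using assms projection_zero_sym by blast
  note P = is_projectionD[OF assms(1)] is_projectionD[OF assms(2)]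
  have sxy: "star x * q = star x" "p * star x = star x" "star y * p = star y" "q * star y = star y"
    "star y * star x = q" "star x * star y = p"
    using xy P by (metis star_mult)+
  have z1: "p * x = 0" "q * y = 0" "q * star x = 0" "p * star y = 0"
    using mult.assoc[of p q x] mult.assoc[of q p y] mult.assoc[of q p "star x"] mult.assoc[of p q "star y"]
    by (simp_all add: xy sxy assms(3) qp)
  have z2: "x * q = 0" "y * p = 0" "star x * p = 0" "star y * q = 0"
    using mult.assoc[of x p q] mult.assoc[of y q p] mult.assoc[of "star x" q p] mult.assoc[of "star y" p q]
    by (simp_all add: xy sxy assms(3) qp)
  have z3: "x * star y = 0" "x * x = 0" "star y * x = 0" "star y * star y = 0"
    using mult.assoc[of x p "star y"] mult.assoc[of x p x] mult.assoc[of "star y" p x]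
      mult.assoc[of "star y" p "star y"] by (simp_all add: xy sxy z1)
  have z4: "y * star x = 0" "y * y = 0" "star x * y = 0" "star x * star x = 0"
    using mult.assoc[of y q "star x"] mult.assoc[of y q y] mult.assoc[of "star x" q y]
      mult.assoc[of "star x" q "star x"] by (simp_all add: xy sxy z1)
  note z = z1 z2 z3 z4
  note rules = P xy sxy z assms(3) qp
  define h where "h = x + star x + (1 - p - q)"
  define g where "g = y + star y + (1 - p - q)"
  have "star h = h" by (simp add: h_def star_add star_diff star_star star_one P)
  moreover have "h * g = 1" "g * h = 1"
    by (simp_all add: h_def g_def algebra_simps rules)
  ultimately obtain s where s: "star s = s" "s * s * (h * h) = 1"
    and s_comm: "\<And>z. z * (h * h) = h * h * z \<Longrightarrow> z * s = s * z"
    using inverse_square_root_square by metis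
  have hp: "h * p = x" "q * h = x" "p * h = star x" "h * q = star x"
    by (simp_all add: h_def algebra_simps rules)
  have sh: "h * s = s * h" by (rule s_comm) (simp add: mult.assoc)
  have "p * (h * h) = h * h * p" "q * (h * h) = h * h * q"
    using hp by (simp_all add: mult.assoc[symmetric] mult.assoc[of h h])
      (simp_all add: h_def algebra_simps rules)
  then have sp: "p * s = s * p" "q * s = s * q" by (auto intro: s_comm)
  \<comment> \<open>Since \<open>star x = p * h = h * q\<close>, this is p U = U q for the unitary U
    = s h.\<close>
  define v where "v = s * star x"
  have vv: "star v = x * s" by (simp add: v_def star_mult star_star s(1))
  have "v * star v = s * (p * h * (h * p)) * s" unfolding vv unfolding v_def hp by (simp add: mult.assoc)
  also have "\<dots> = p * (s * s * (h * h)) * p"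
    by (simp add: mult.assoc sp sh sp[THEN mult_assoc_eq] sh[THEN mult_assoc_eq])
  also have "\<dots> = p" using s(2) P by simp
  finally have 1: "v * star v = p" .
  have "star v * v = q * h * (s * s) * (h * q)" unfolding vv unfolding v_def hp by (simp add: mult.assoc)
  also have "\<dots> = q * (s * s * (h * h)) * q"
    by (simp add: mult.assoc sp sh sp[THEN mult_assoc_eq] sh[THEN mult_assoc_eq])
  also have "\<dots> = q" using s(2) P by simp
  finally show thesis using 1 that by blast
qed

lemma idempotent_range_projection:
  fixes e :: "'a::unital_cstar_algebra"
  assumes "e * e = e"
  obtains r where "is_projection r" "r * e = e" "e * r = r"
proof -
  let ?f = "star e"
  define k where "k = cscale \<i> (e - ?f)"
  have f: "?f * ?f = ?f" using assms by (metis star_mult)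
  have "star k = cscale (- \<i>) (?f - e)" by (simp add: k_def star_cscale star_diff star_star)
  also have "\<dots> = cscale (- \<i>) (cscale (-1) (e - ?f))" using cscale_of_real[of "-1" "e - ?f"] by simp
  also have "\<dots> = k" by (simp add: cscale_cscale k_def)
  finally have sk: "star k = k" .
  have "k * k = cscale (-1) ((e - ?f) * (e - ?f))"
    by (simp add: k_def mult_cscale_left mult_cscale_right cscale_cscale)
  also have "\<dots> = - ((e - ?f) * (e - ?f))"
    using cscale_of_real[of "-1" "(e - ?f) * (e - ?f)"] by simp
  finally have kk: "k * k = e * ?f + ?f * e - e - ?f" using assms f by (simp add: algebra_simps)
  obtain s where s: "star s = s" "s * s * (1 + k * k) = 1"
    and s_comm: "\<And>z. z * (k * k) = k * k * z \<Longrightarrow> z * s = s * z"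
    using inverse_square_root_one_plus_square[OF sk] by blast
  note rules = assms f assms[THEN mult_assoc_eq] f[THEN mult_assoc_eq]
  have es: "e * s = s * e" "?f * s = s * ?f"
    by (rule s_comm; simp add: kk algebra_simps rules)+
  have sz: "(1 + k * k) * s = s * (1 + k * k)" 
    using s_comm[of "k * k"] by (simp add: algebra_simps)
  have ez: "e * (1 + k * k) = e * ?f * e" by (simp add: kk algebra_simps rules)
  let ?t = "s * s"
  have et: "e * ?t = ?t * e" "?f * ?t = ?t * ?f" using es by (metis mult.assoc)+
  have zt: "(1 + k * k) * ?t = 1" using s(2) sz by (metis mult.assoc)
  let ?r = "e * ?f * ?t"
  have re: "?r * e = e"
  proof -
    have "?r * e = e * ?f * e * ?t" using et by (metis mult.assoc)
    also have "\<dots> = e * ((1 + k * k) * ?t)" unfolding ez[symmetric] by (rule mult.assoc)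
    finally show ?thesis using zt by simp
  qed
  show thesis
  proof (rule that)
    show "?r * e = e" by (rule re)
    show "e * ?r = ?r" by (simp add: mult.assoc[symmetric] assms)
    have "?r * ?r = ?r * e * ?f * ?t" by (simp add: mult.assoc)
    moreover have "star ?r = ?r" using et by (simp add: star_mult star_star s(1) mult.assoc) (metis mult.assoc)
    ultimately show "is_projection ?r" using re by (simp add: is_projection_def)
  qed
qed

section \<open>Invertibility up to a pair of projections\<close>

text \<open>The working form for the full algebra: the conditions \<open>p * b = 0\<close> and
  \<open>b * q = 0\<close> absorb one of the two compressions of a in each product.\<close>

lemma invertible_up_to_UNIV_iff:
  fixes a :: "'a::unital_cstar_algebra"
  assumes "is_projection p" "is_projection q"
  shows "invertible_up_to UNIV 1 a p q \<longleftrightarrow>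
    (\<exists>b. p * b = 0 \<and> b * q = 0 \<and> (1 - q) * (a * b) = 1 - q \<and> b * a * (1 - p) = 1 - p)"
proof -
  note P = is_projectionD[OF assms(1)] is_projectionD[OF assms(2)]
  have 1: "b = (1 - p) * b * (1 - q) \<longleftrightarrow> p * b = 0 \<and> b * q = 0" (is "?l \<longleftrightarrow> ?r") for b
  proof
    assume b: ?l
    have "p * ((1 - p) * b * (1 - q)) = 0" "(1 - p) * b * (1 - q) * q = 0"
      by (simp_all add: algebra_simps P)
    with b show ?r by metis
  qed (simp add: algebra_simps)
  have 2: "(1 - q) * a * (1 - p) * b = (1 - q) * (a * b)" if "p * b = 0" for b
    using that by (simp add: algebra_simps)
  have 3: "b * ((1 - q) * a * (1 - p)) = b * a * (1 - p)" if "b * q = 0" for b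
    using that by (simp add: algebra_simps mult_assoc_eq[OF that])
  show ?thesis unfolding invertible_up_to_def Let_def using 1 2 3 by (metis UNIV_I)
qed

text \<open>Adjoints exchange the two entries of a pair, so that a construction for the first entry
  also serves the second.\<close>

lemma invertible_up_to_star:
  fixes a :: "'a::unital_cstar_algebra"
  assumes "is_projection p" "is_projection q" "invertible_up_to UNIV 1 a p q"
  shows "invertible_up_to UNIV 1 (star a) q p"
proof -
  obtain b where b: "p * b = 0" "b * q = 0" "(1 - q) * (a * b) = 1 - q" "b * a * (1 - p) = 1 - p"
    using assms invertible_up_to_UNIV_iff by blast
  have s: "star (1 - p) = 1 - p" "star (1 - q) = 1 - q" "star p = p" "star q = q"
    using assms by (simp_all add: is_projection_def star_diff star_one)
  have "star b * p = 0" "q * star b = 0"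
    using b(1,2) s by (metis star_mult star_zero)+
  moreover have "star b * star a * (1 - q) = 1 - q" "(1 - p) * (star a * star b) = 1 - p"
    using b(3,4) s by (metis star_mult)+
  ultimately show ?thesis using invertible_up_to_UNIV_iff assms(1,2) by blast
qed

lemma norm_mult3_le:
  fixes x y z :: "'a::unital_cstar_algebra"
  assumes "norm x \<le> r" "norm y \<le> s" "norm z \<le> t"
  shows "norm (x * y * z) \<le> r * s * t"
proof -
  have "0 \<le> r" "0 \<le> s" using assms norm_ge_zero[of x] norm_ge_zero[of y] by linarith+
  have "norm (x * y * z) \<le> norm x * norm y * norm z"
    by (meson mult_right_mono norm_ge_zero norm_mult_ineq order_trans)
  also have "\<dots> \<le> r * s * t" using assms \<open>0 \<le> r\<close> \<open>0 \<le> s\<close> by (intro mult_mono) auto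
  finally show ?thesis .
qed

text \<open>For p' near p, the old inverse b is nearly a left and a right inverse of the new
  compression of a. Neumann series correct it to a left inverse c and a right inverse c', which must
  coincide.\<close>

lemma invertible_up_to_perturb:
  fixes a :: "'a::unital_cstar_algebra"
  assumes "is_projection p" "is_projection q" "invertible_up_to UNIV 1 a p q"
  obtains \<delta> where "\<delta> > 0"
    "\<And>p'. is_projection p' \<Longrightarrow> norm (p' - p) < \<delta> \<Longrightarrow> invertible_up_to UNIV 1 a p' q"
proof -
  obtain b where b: "p * b = 0" "b * q = 0" "(1 - q) * (a * b) = 1 - q" "b * a * (1 - p) = 1 - p"
    using assms invertible_up_to_UNIV_iff by blast
  define f where "f = 1 - b * a"
  \<comment> \<open>M dominates both \<open>norm f\<close> and \<open>norm a * norm b\<close>, so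
    that p' within 1/M of p makes the errors k and k' below smaller than 1.\<close>
  define M where "M = norm f + norm a * norm b + 1"
  have M: "M > 0" by (simp add: M_def add_nonneg_pos)
  have fp: "f * p = f" using b(4) by (simp add: f_def algebra_simps)
  note Q = is_projectionD[OF assms(2)]
  have "invertible_up_to UNIV 1 a p' q" if p': "is_projection p'" "norm (p' - p) < 1 / M" for p'
  proof -
    note P' = is_projectionD[OF p'(1)]
    have small: "norm (p' - p) * M < 1" using p'(2) M by (simp add: field_simps)
    have c1: "norm (1 - p') \<le> 1" "norm (1 - q) \<le> 1"
      using p' assms(2) by (auto intro: norm_projection_le is_projection_complement)
    define k where "k = (1 - p') * f * (1 - p')"
    have "k = (1 - p') * (f * (p - p')) * (1 - p')"
      using fp by (simp add: k_def algebra_simps P')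
    also have "norm \<dots> \<le> 1 * (norm f * norm (p' - p)) * 1"
      using c1 norm_mult_ineq[of f "p - p'"] by (intro norm_mult3_le) (auto simp: norm_minus_commute)
    also have "\<dots> \<le> norm (p' - p) * M"
      by (simp add: M_def algebra_simps)
    finally have "norm k < 1" using small by simp
    then obtain n where n: "n * (1 - k) = 1" "\<And>z. z * k = k * z \<Longrightarrow> z * n = n * z"
      using neumann_inverse by metis
    have kp: "p' * k = 0" "k * p' = 0" by (simp_all add: k_def algebra_simps P')
    then have np: "p' * n = n * p'" using n(2) by simp
    define k' where "k' = (1 - q) * (a * (p' - p)) * b"
    have "norm k' \<le> 1 * (norm a * norm (p' - p)) * norm b"
      unfolding k'_def using c1 norm_mult_ineq[of a "p' - p"] by (intro norm_mult3_le) auto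
    also have "\<dots> \<le> norm (p' - p) * M" by (simp add: M_def algebra_simps)
    finally have "norm k' < 1" using small by simp
    then obtain n' where n': "(1 - k') * n' = 1" "\<And>z. z * k' = k' * z \<Longrightarrow> z * n' = n' * z"
      using neumann_inverse by metis
    have kq: "q * k' = 0" "k' * q = 0" using b(2) by (simp_all add: k'_def algebra_simps Q)
    then have nq: "q * n' = n' * q" using n'(2) by simp
    define c where "c = n * ((1 - p') * b)"
    define c' where "c' = (1 - p') * b * n'"
    have "c * q = 0" using b(2) by (simp add: c_def mult.assoc)
    have "c * a * (1 - p') = n * ((1 - p') * (1 - f) * (1 - p'))"
      by (simp add: c_def f_def mult.assoc)
    also have "(1 - p') * (1 - f) * (1 - p') = (1 - k) * (1 - p')"
      by (simp add: k_def algebra_simps P')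
    also have "n * \<dots> = 1 - p'" using n(1) by (simp add: mult.assoc[symmetric])
    finally have cl: "c * a * (1 - p') = 1 - p'" .
    have "p' * c' = 0" by (simp add: c'_def algebra_simps P')
    have "c' * q = (1 - p') * (b * q) * n'" using nq by (simp add: c'_def mult.assoc)
    then have "c' * q = 0" using b(2) by simp
    have "(1 - q) * (a * c') = ((1 - q) * (a * b) - (1 - q) * (a * p' * b)) * n'"
      by (simp add: c'_def algebra_simps)
    also have "(1 - q) * (a * b) - (1 - q) * (a * p' * b) = (1 - q) * (1 - k')"
      unfolding b(3) using b(1) kq by (simp add: k'_def algebra_simps Q)
    also have "\<dots> * n' = 1 - q" using n'(1) by (simp add: mult.assoc)
    finally have cr: "(1 - q) * (a * c') = 1 - q" .
    have "p' * c = n * (p' * ((1 - p') * b))" using np by (simp add: c_def mult.assoc[symmetric])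
    also have "\<dots> = 0" by (simp add: algebra_simps P')
    finally have "p' * c = 0" .
    \<comment> \<open>The left inverse equals the right inverse by evaluating c a c' in two
      ways.\<close>
    have "c = c * ((1 - q) * (a * c'))" unfolding cr using \<open>c * q = 0\<close> by (simp add: algebra_simps)
    also have "\<dots> = c * a * (1 - p') * c'"
      using \<open>p' * c' = 0\<close> by (simp add: algebra_simps mult_assoc_eq[OF \<open>c * q = 0\<close>])
    also have "\<dots> = c'" unfolding cl using \<open>p' * c' = 0\<close> by (simp add: algebra_simps)
    finally show ?thesis
      using invertible_up_to_UNIV_iff[OF p'(1) assms(2)] cl cr \<open>p' * c = 0\<close> \<open>c * q = 0\<close> by blast
  qed
  then show thesis using that[of "1 / M"] M by simp
qed


section \<open>The index in the full algebra\<close>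

locale unital_finite_type = finite_type UNIV F for F :: "'a::unital_cstar_algebra set"
begin

abbreviation "S \<equiv> proj_semigroup UNIV F"

sublocale S: comm_monoid S
  by (rule proj_semigroup_comm_monoid)

lemma ProjD: "p \<in> Proj F \<Longrightarrow> p \<in> F" "p \<in> Proj F \<Longrightarrow> is_projection p"
  by (simp_all add: Proj_def)

lemma ProjI: "p \<in> F \<Longrightarrow> is_projection p \<Longrightarrow> p \<in> Proj F"
  by (simp add: Proj_def)

lemma F_mult: "x \<in> F \<Longrightarrow> a * x \<in> F" "x \<in> F \<Longrightarrow> x * a \<in> F"
  using F_ideal by simp_all

lemma Proj_diff:
  assumes "p \<in> Proj F" "u \<in> Proj F" "u * p = p"
  shows "u - p \<in> Proj F"
proof (rule ProjI)
  have "u - p = u * (1 - p)" using assms(3) by (simp add: algebra_simps)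
  then show "u - p \<in> F" using F_mult assms(2) ProjD by metis
  show "is_projection (u - p)" using is_projection_diff assms ProjD by blast
qed

lemma class_diff:
  assumes "p \<in> Proj F" "u \<in> Proj F" "u * p = p"
  shows "R `` {u} = R `` {p} \<otimes>\<^bsub>S\<^esub> R `` {u - p}"
proof -
  have "p * (u - p) = 0"
    using assms projection_le_sym[of p u] by (simp add: ProjD algebra_simps is_projectionD)
  then have "proj_perp p (u - p)" using proj_perp_iff Proj_diff assms ProjD by metis
  then show ?thesis using S_mult[OF assms(1) Proj_diff[OF assms]] by simp
qed

text \<open>The finite type axiom replaces q by an equivalent q' orthogonal to p. The algebraic
  equivalence carries over to p and q', where orthogonality permits the passage to a partial
  isometry.\<close>

lemma alg_equiv_imp_class_eq:
  assumes "p \<in> Proj F" "q \<in> Proj F" "alg_equiv p q"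
  shows "R `` {p} = R `` {q}"
proof -
  obtain q' where q': "q' \<in> Proj F" "proj_perp p q'" "R `` {q} = R `` {q'}"
    using perp_rep[OF assms(1,2)] by blast
  have "(q, q') \<in> R" using q' assms(2) eq_equiv_class[OF q'(3) mvn_equiv] by blast
  then obtain w where w: "w * star w = q" "star w * w = q'" by (auto simp: mvn_rel_def)
  have qw: "q * w = w" using mvn_absorb[OF w(1)] assms(2) ProjD by blast
  have qw': "q' * star w = star w" using mvn_absorb[of "star w" q'] w(2) q'(1) ProjD by (simp add: star_star)
  have ws: "star w * q = star w" "w * q' = w"
    using qw qw' assms(2) q'(1) by (metis ProjD(2) is_projectionD(2) star_mult star_star)+
  obtain x y where xy: "q * x = x" "x * p = x" "p * y = y" "y * q = y" "x * y = q" "y * x = p"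
    using assms(3) by (auto simp: alg_equiv_def)
  note rules = xy xy[THEN mult_assoc_eq] w w[THEN mult_assoc_eq] qw qw' ws qw[THEN mult_assoc_eq]
    qw'[THEN mult_assoc_eq] ws[THEN mult_assoc_eq]
  have "alg_equiv p q'"
    unfolding alg_equiv_def
    by (rule exI[of _ "star w * x"], rule exI[of _ "y * w"]) (simp add: mult.assoc rules)
  moreover have "p * q' = 0" using q'(1,2) assms(1) proj_perp_iff ProjD by blast
  ultimately obtain v where "v * star v = p" "star v * v = q'"
    using alg_equiv_orthogonal_imp_mvn assms(1) q'(1) ProjD by metis
  then have "(p, q') \<in> R" using assms(1) q'(1) by (auto simp: mvn_rel_def)
  then show ?thesis using q'(3) equiv_class_eq[OF mvn_equiv] by metis
qed

text \<open>The projection is \<open>u p (p u p)\<^sup>-\<^sup>1 p u\<close>, where the inverse is taken in the corner of \<open>p\<close>.\<close>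

lemma nearby_subprojection:
  assumes p: "p \<in> Proj F" and u: "is_projection u" and \<epsilon>: "norm (u * p - p) \<le> \<epsilon>" "\<epsilon> \<le> 1 / 2"
  obtains p' where "p' \<in> Proj F" "u * p' = p'" "norm (p' - p) \<le> 6 * \<epsilon>" "R `` {p'} = R `` {p}"
proof -
  note P = is_projectionD[OF ProjD(2)[OF p]] and U = is_projectionD[OF u]
  have np: "norm p \<le> 1" "norm u \<le> 1" using norm_projection_le p u ProjD by blast+
  have \<epsilon>0: "0 \<le> \<epsilon>" using \<epsilon>(1) norm_ge_zero order_trans by blast
  have le: "norm (x * y) \<le> r * s" if "norm x \<le> r" "norm y \<le> s" for x y :: 'a and r s
    using that by (intro order_trans[OF norm_mult_ineq] mult_mono) (auto intro: order_trans[OF norm_ge_zero])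
  \<comment> \<open>Chosen so that \<open>p - k\<close> is p u p; its inverse in the corner of p is
    then n p with n = (1 - k)^-1.\<close>
  define k where "k = p * (p - u * p)"
  have "norm k \<le> 1 * \<epsilon>" unfolding k_def using np \<epsilon> by (intro le) (auto simp: norm_minus_commute)
  then have k: "norm k \<le> \<epsilon>" "norm k < 1" using \<epsilon> by auto
  have sk: "star k = k" by (simp add: k_def star_mult star_diff P U algebra_simps)
  obtain n where n: "n * (1 - k) = 1" "(1 - k) * n = 1" "\<And>z. z * k = k * z \<Longrightarrow> z * n = n * z"
    "star n = n" "norm n \<le> 1 / (1 - norm k)"
    using neumann_inverse[OF k(2)] sk by metis
  have pk: "p * k = k" "k * p = k" by (simp_all add: k_def algebra_simps P)
  have pn: "p * n = n * p" using pk by (intro n(3)) simp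
  have "1 / (1 - norm k) \<le> 2" using k \<epsilon>(2) by (simp add: field_simps)
  then have nn: "norm n \<le> 2" using n(5) by simp
  have "n - 1 = n * k" using n(1) by (simp add: algebra_simps)
  then have nn1: "norm (n - 1) \<le> 2 * \<epsilon>" using le[OF nn k(1)] by simp
  have "p - k = p * u * p" by (simp add: k_def algebra_simps P)
  moreover have "p - k = (1 - k) * p" using pk by (simp add: algebra_simps)
  then have "n * (p - k) = p" using mult_assoc_eq[OF n(1), of p] by simp
  moreover have "p - k = p * (1 - k)" using pk by (simp add: algebra_simps)
  then have "(p - k) * n = p" using n(2) by (simp add: mult.assoc)
  ultimately have npup: "n * (p * (u * p)) = p" "p * (u * (p * n)) = p" by (simp_all add: mult.assoc)
  define p' where "p' = u * p * n * p * u"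
  have "p' * p' = u * p * n * (p * (u * (u * p)) * n) * p * u" by (simp add: p'_def mult.assoc)
  also have "\<dots> = p'" using npup by (simp add: p'_def mult.assoc P U)
  finally have pp: "p' * p' = p'" .
  moreover have "star p' = p'" by (simp add: p'_def star_mult n(4) P U mult.assoc)
  ultimately have "is_projection p'" by (simp add: is_projection_def)
  moreover have "p' \<in> F" using ProjD(1)[OF p] by (simp add: p'_def F_mult)
  ultimately have p': "p' \<in> Proj F" by (rule ProjI[rotated])
  have up: "u * p' = p'" by (simp add: p'_def mult.assoc U)
  have "alg_equiv p p'"
    unfolding alg_equiv_def
  proof (intro exI conjI)
    let ?x = "u * p" and ?y = "n * (p * u)"
    show "?x * p = ?x" by (simp add: mult.assoc P)
    show "p * ?y = ?y" using pn by (simp add: mult.assoc[symmetric]) (simp add: mult.assoc P)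
    show "?x * ?y = p'" by (simp add: p'_def mult.assoc)
    show yx: "?y * ?x = p" using npup by (simp add: mult.assoc U)
    show "p' * ?x = ?x"
    proof -
      have "p' * ?x = ?x * (?y * ?x)" by (simp add: p'_def mult.assoc)
      then show ?thesis unfolding yx by (simp add: mult.assoc P)
    qed
    show "?y * p' = ?y"
    proof -
      have "?y * p' = ?y * ?x * ?y" by (simp add: p'_def mult.assoc)
      then show ?thesis unfolding yx using pn by (simp add: mult.assoc[symmetric]) (simp add: mult.assoc P)
    qed
  qed
  then have "R `` {p'} = R `` {p}" using alg_equiv_imp_class_eq[OF p p'] by simp
  moreover have "norm (p' - p) \<le> 6 * \<epsilon>"
  proof -
    have "norm (p * u - p) = norm (star (u * p - p))" by (simp add: star_diff star_mult P U)
    then have pu: "norm (p * u - p) \<le> \<epsilon>" using \<epsilon>(1) by (simp only: norm_star)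
    have a: "norm ((u * p - p) * n * (p * u)) \<le> \<epsilon> * 2 * (1 * 1)"
      using np nn \<epsilon> by (intro norm_mult3_le le)
    have b: "norm (p * n * (p * u - p)) \<le> 1 * 2 * \<epsilon>" using np nn pu by (intro norm_mult3_le)
    have c: "norm (p * (n - 1) * p) \<le> 1 * (2 * \<epsilon>) * 1" using np nn1 by (intro norm_mult3_le)
    \<comment> \<open>The factors u, u and n of p' are removed one at a time. Each removal costs at
      most 2 \<epsilon>, whence the constant 6.\<close>
    have "p' - p = (u * p - p) * n * (p * u) + p * n * (p * u - p) + p * (n - 1) * p"
      by (simp add: p'_def algebra_simps P)
    also have "norm \<dots> \<le> \<epsilon> * 2 * (1 * 1) + 1 * 2 * \<epsilon> + 1 * (2 * \<epsilon>) * 1"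
      by (intro norm_triangle_le add_mono a b c)
    finally show ?thesis by simp
  qed
  ultimately show thesis using that p' up by blast
qed

section \<open>Projections that dominate exactly or approximately\<close>

lemma projection_approx_unit:
  assumes "x \<in> F" "y \<in> F" "\<epsilon> > 0"
  obtains u where "u \<in> Proj F" "norm (u * x - x) < \<epsilon>" "norm (u * y - y) < \<epsilon>"
proof -
  obtain \<Phi> where \<Phi>: "approximate_unit F \<Phi>" "\<forall>\<^sub>F u in \<Phi>. is_projection u"
    using ideal unfolding finite_type_ideal_def by blast
  have "\<forall>\<^sub>F u in \<Phi>. u \<in> F" "\<Phi> \<noteq> bot" using \<Phi>(1) by (auto simp: approximate_unit_def)
  moreover have "\<forall>\<^sub>F u in \<Phi>. norm (u * z - z) < \<epsilon>" if "z \<in> F" for z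
    using \<Phi>(1) that tendstoD[of "\<lambda>u. u * z" z \<Phi> \<epsilon>] assms(3)
    by (auto simp: approximate_unit_def dist_norm)
  ultimately have "\<forall>\<^sub>F u in \<Phi>. u \<in> Proj F \<and> norm (u * x - x) < \<epsilon> \<and> norm (u * y - y) < \<epsilon>"
    using \<Phi>(2) assms(1,2) by (auto simp: Proj_def eventually_conj_iff)
  then show thesis using that eventually_happens'[OF \<open>\<Phi> \<noteq> bot\<close>] by blast
qed

text \<open>Take v from the approximate unit, nearly dominating p and q. Move p to p' below v, split
  v = p' + w, and move w to r below 1 - p. Then u = p + r dominates p exactly and is still close to
  v.\<close>

lemma dominating_approx_unit:
  assumes p: "p \<in> Proj F" and q: "q \<in> Proj F" and \<epsilon>: "\<epsilon> > 0"
  obtains u where "u \<in> Proj F" "u * p = p" "norm (u * q - q) < \<epsilon>"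
proof -
  \<comment> \<open>The displacements 6 \<delta> of p and 36 \<delta> of w and the error \<delta> of
    v add up to 43 \<delta> < \<epsilon>. The bound 1/12 keeps 6 \<delta> at most 1/2, as moving w
    requires.\<close>
  define \<delta> where "\<delta> = min (\<epsilon> / 44) (1 / 12)"
  have \<delta>: "\<delta> > 0" "\<delta> \<le> 1 / 2" "6 * \<delta> \<le> 1 / 2" "44 * \<delta> \<le> \<epsilon>" using \<epsilon> by (auto simp: \<delta>_def min_def)
  obtain v where v: "v \<in> Proj F" "norm (v * p - p) < \<delta>" "norm (v * q - q) < \<delta>"
    using projection_approx_unit[OF ProjD(1)[OF p] ProjD(1)[OF q] \<delta>(1)] by blast
  obtain p' where p': "p' \<in> Proj F" "v * p' = p'" "norm (p' - p) \<le> 6 * \<delta>"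
    using nearby_subprojection[OF p ProjD(2)[OF v(1)] less_imp_le[OF v(2)] \<delta>(2)] by blast
  define w where "w = v - p'"
  have w: "w \<in> Proj F" using Proj_diff p' v(1) by (simp add: w_def)
  have "p' * v = p'" using p' v(1) projection_le_sym ProjD by blast
  then have "p' * w = 0" using p' by (simp add: w_def algebra_simps ProjD is_projectionD)
  then have "(1 - p) * w - w = (p' - p) * w" by (simp add: algebra_simps)
  also have "norm \<dots> \<le> norm (p' - p) * norm w" by (rule norm_mult_ineq)
  also have "\<dots> \<le> 6 * \<delta> * 1" using p'(3) norm_projection_le[OF ProjD(2)[OF w]] \<delta> by (intro mult_mono) auto
  finally have "norm ((1 - p) * w - w) \<le> 6 * \<delta>" by simp
  then obtain r where r: "r \<in> Proj F" "(1 - p) * r = r" "norm (r - w) \<le> 6 * (6 * \<delta>)"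
    using nearby_subprojection[OF w is_projection_complement[OF ProjD(2)[OF p]] _ \<delta>(3)] by blast
  have pr: "p * r = 0" using r(2) by (simp add: algebra_simps)
  then have perp: "proj_perp p r" using proj_perp_iff p r(1) ProjD by blast
  have "r * p = 0" using pr projection_zero_sym p r(1) ProjD by blast
  then have up: "(p + r) * p = p" using p by (simp add: algebra_simps ProjD is_projectionD)
  have "(p + r) * q - q = (r - w) * q + (v * q - q) - (p' - p) * q" by (simp add: w_def algebra_simps)
  also have "norm \<dots> \<le> norm ((r - w) * q) + norm (v * q - q) + norm ((p' - p) * q)"
    by (intro order_trans[OF norm_triangle_ineq4] add_mono norm_triangle_ineq) auto
  also have "\<dots> < 36 * \<delta> + \<delta> + 6 * \<delta>"
  proof -
    have "norm (x * q) \<le> norm x" for x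
      using norm_mult_ineq[of x q] norm_projection_le[OF ProjD(2)[OF q]] mult_left_le[of "norm q" "norm x"]
      by simp
    from this[of "r - w"] this[of "p' - p"] show ?thesis using r(3) p'(3) v(3) by simp
  qed
  also have "\<dots> \<le> \<epsilon>" using \<delta> by simp
  finally show thesis using that[of "p + r"] Proj_add[OF p r(1) perp] up by blast
qed

text \<open>The projection \<open>1 - q'\<close> is the range projection of \<open>(1 - q) a (1 - u)\<close>. The complementary part
  of \<open>a\<close> identifies \<open>u - p\<close> with an idempotent having the same kernel as \<open>q' - q\<close>.\<close>

lemma invertible_up_to_enlarge:
  assumes p: "p \<in> Proj F" and q: "q \<in> Proj F" and u: "u \<in> Proj F" "u * p = p"
    and inv: "invertible_up_to UNIV 1 a p q"
  obtains q' where "q' \<in> Proj F" "q' * q = q" "invertible_up_to UNIV 1 a u q'"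
    "R `` {u} \<otimes>\<^bsub>S\<^esub> R `` {q} = R `` {p} \<otimes>\<^bsub>S\<^esub> R `` {q'}"
proof -
  note prj = ProjD(2)[OF p] ProjD(2)[OF q] ProjD(2)[OF u(1)]
  note P = is_projectionD[OF prj(1)] and Q = is_projectionD[OF prj(2)] and U = is_projectionD[OF prj(3)]
  have pu: "p * u = p" using u(2) projection_le_sym prj by blast
  obtain b where b: "p * b = 0" "b * q = 0" "(1 - q) * (a * b) = 1 - q" "b * a * (1 - p) = 1 - p"
    using invertible_up_to_UNIV_iff[OF prj(1,2)] inv by blast
  have bax: "b * (a * x) = x" if "p * x = 0" for x
  proof -
    have "b * (a * x) = b * a * (1 - p) * x" using that by (simp add: algebra_simps)
    also have "\<dots> = x" unfolding b(4) using that by (simp add: algebra_simps)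
    finally show ?thesis .
  qed
  \<comment> \<open>The splitting 1 - p = (1 - u) + (u - p) cuts a into x and \<alpha>, and b into l
    and \<beta>; then x l + \<alpha> \<beta> = 1 - q.\<close>
  define x where "x = (1 - q) * a * (1 - u)"
  define l where "l = (1 - u) * b"
  have "l * x = (1 - u) * (b * (a * (1 - u)))"
    by (simp add: l_def x_def algebra_simps mult_assoc_eq[OF b(2)])
  also have "b * (a * (1 - u)) = 1 - u" using pu by (intro bax) (simp add: algebra_simps)
  finally have lx: "l * x = 1 - u" by (simp add: algebra_simps U)
  have xu: "x * (1 - u) = x" "l * q = 0" "q * x = 0"
    using b(2) by (simp_all add: x_def l_def algebra_simps U Q)
  \<comment> \<open>An idempotent with the same range as x; its range projection r will be 1 -
    q'.\<close>
  define e where "e = x * l"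
  have ex: "e * x = x" using xu(1) lx by (simp add: e_def mult.assoc)
  have ee: "e * e = e" using ex by (simp add: e_def mult.assoc[symmetric])
  obtain r where r: "is_projection r" "r * e = e" "e * r = r" using idempotent_range_projection[OF ee] .
  have eq: "e * q = 0" "q * e = 0" using xu by (simp_all add: e_def mult.assoc[symmetric]) (simp add: mult.assoc)
  have qr: "q * r = 0" using eq(2) r(3) by (metis mult.assoc mult_zero_left)
  then have rq: "r * q = 0" using projection_zero_sym prj r(1) by blast
  have rx: "r * x = x" using ex r(2) by (metis mult.assoc)
  define \<alpha> where "\<alpha> = (1 - q) * a * (u - p)"
  define \<beta> where "\<beta> = (u - p) * b"
  define g where "g = 1 - q - e"
  have g: "g = \<alpha> * \<beta>"
  proof -
    have "\<alpha> * \<beta> = (1 - q) * (a * b) - (1 - q) * (a * (1 - u) * b)"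
      using b(1) u(2) pu
      by (simp add: \<alpha>_def \<beta>_def algebra_simps U P mult_assoc_eq[OF u(2)] mult_assoc_eq[OF pu])
    also have "\<dots> = g" unfolding b(3) by (simp add: g_def e_def x_def l_def algebra_simps U)
    finally show ?thesis by simp
  qed
  have "\<beta> * \<alpha> = (u - p) * (b * (a * (u - p)))"
    by (simp add: \<alpha>_def \<beta>_def algebra_simps mult_assoc_eq[OF b(2)])
  also have "b * (a * (u - p)) = u - p" using pu P by (intro bax) (simp add: algebra_simps)
  finally have \<beta>\<alpha>: "\<beta> * \<alpha> = u - p" using u(2) pu by (simp add: algebra_simps U P)
  define q' where "q' = 1 - r"
  have prq': "is_projection q'" using is_projection_complement r(1) by (simp add: q'_def)
  have "q' * e = 0" using r(2) by (simp add: q'_def algebra_simps)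
  \<comment> \<open>As \<open>q + g\<close> is 1 - e and g contains the factor \<open>u - p\<close>
    from F, this places q' in F.\<close>
  then have "q' = q' * (q + g)" by (simp add: g_def algebra_simps)
  moreover have "q + g \<in> F" unfolding g \<alpha>_def \<beta>_def
    using F_add F_mult ProjD Proj_diff[OF p u] q by simp
  ultimately have q'F: "q' \<in> Proj F" using F_mult prq' ProjI by metis
  have q'q: "q' * q = q" using rq by (simp add: q'_def algebra_simps)
  have "invertible_up_to UNIV 1 a u q'"
    unfolding invertible_up_to_UNIV_iff[OF prj(3) prq']
  proof (intro exI conjI)
    \<comment> \<open>The inverse is \<open>l * r\<close>; it works because r a (1 - u) = x and l x
      = 1 - u.\<close>
    show "u * (l * r) = 0" by (simp add: l_def algebra_simps U)
    show "l * r * q' = 0" using r(1) by (simp add: q'_def algebra_simps is_projectionD)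
    have ra: "r * a * (1 - u) = x"
      using rx rq by (simp add: x_def algebra_simps mult_assoc_eq[OF rq])
    have "(1 - q') * (a * (l * r)) = r * a * (1 - u) * l * r"
      by (simp add: q'_def l_def algebra_simps U)
    also have "\<dots> = e * r" unfolding ra by (simp add: e_def)
    finally show "(1 - q') * (a * (l * r)) = 1 - q'" using r(3) by (simp add: q'_def)
    have "l * r * a * (1 - u) = l * (r * a * (1 - u))" by (simp add: mult.assoc)
    then show "l * r * a * (1 - u) = 1 - u" unfolding ra lx .
  qed
  moreover have "alg_equiv (u - p) (q' - q)"
    unfolding alg_equiv_def
  proof (intro exI conjI)
    let ?s = "q' - q"
    \<comment> \<open>The first two equations express that the idempotents g and q' - q have the
      same kernel.\<close>
    have gs: "g * ?s = g" "?s * g = ?s" "?s * ?s = ?s"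
      using eq qr rq r by (simp_all add: g_def q'_def algebra_simps Q is_projectionD)
    have gg: "g * g = g" using eq ee by (simp add: g_def algebra_simps Q)
    have \<alpha>: "\<alpha> * (u - p) = \<alpha>" "(u - p) * \<beta> = \<beta>"
      using u(2) pu by (simp_all add: \<alpha>_def \<beta>_def algebra_simps U P mult_assoc_eq[OF u(2)] mult_assoc_eq[OF pu])
    have g\<alpha>: "g * \<alpha> = \<alpha>" "\<beta> * g = \<beta>" using \<beta>\<alpha> \<alpha> by (simp_all add: g mult.assoc mult_assoc_eq[OF \<beta>\<alpha>])
    show "?s * (?s * \<alpha>) = ?s * \<alpha>" by (rule mult_assoc_eq[OF gs(3)])
    show "?s * \<alpha> * (u - p) = ?s * \<alpha>" using \<alpha> by (simp add: mult.assoc)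
    show "(u - p) * (\<beta> * ?s) = \<beta> * ?s" by (rule mult_assoc_eq[OF \<alpha>(2)])
    show "\<beta> * ?s * ?s = \<beta> * ?s" using gs(3) by (simp add: mult.assoc)
    have "?s * \<alpha> * (\<beta> * ?s) = ?s * g * ?s" unfolding g by (simp only: mult.assoc)
    then show "?s * \<alpha> * (\<beta> * ?s) = ?s" unfolding gs by simp
    have "\<beta> * ?s * (?s * \<alpha>) = \<beta> * g * (?s * ?s) * (g * \<alpha>)" unfolding g\<alpha> by (simp only: mult.assoc)
    also have "\<dots> = \<beta> * (g * ?s * g) * \<alpha>" unfolding gs(3) by (simp only: mult.assoc)
    also have "\<dots> = u - p" unfolding gs gg g\<alpha> by (rule \<beta>\<alpha>)
    finally show "\<beta> * ?s * (?s * \<alpha>) = u - p" .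
  qed
  then have "R `` {u - p} = R `` {q' - q}"
    using alg_equiv_imp_class_eq Proj_diff[OF p u] Proj_diff[OF q q'F q'q] by blast
  then have "R `` {u} \<otimes>\<^bsub>S\<^esub> R `` {q} = R `` {p} \<otimes>\<^bsub>S\<^esub> R `` {q'}"
    unfolding class_diff[OF p u] class_diff[OF q q'F q'q]
    using p q Proj_diff[OF q q'F q'q] by (simp add: S_class S.m_ac)
  ultimately show thesis using that q'F q'q by blast
qed

text \<open>Since u only nearly dominates p, the pair is first perturbed: p is replaced by an
  equivalent subprojection p' of u, close enough to p to keep invertibility, and then p' is enlarged
  to u.\<close>

lemma invertible_up_to_dominating:
  assumes p: "p \<in> Proj F" and q: "q \<in> Proj F" and s: "s \<in> Proj F"
    and inv: "invertible_up_to UNIV 1 a p q"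
  obtains u q' where "u \<in> Proj F" "q' \<in> Proj F" "u * s = s" "q' * q = q" "invertible_up_to UNIV 1 a u q'"
    "R `` {u} \<otimes>\<^bsub>S\<^esub> R `` {q} = R `` {p} \<otimes>\<^bsub>S\<^esub> R `` {q'}"
proof -
  obtain \<delta> where \<delta>: "\<delta> > 0"
    "\<And>p'. is_projection p' \<Longrightarrow> norm (p' - p) < \<delta> \<Longrightarrow> invertible_up_to UNIV 1 a p' q"
    using invertible_up_to_perturb ProjD p q inv by metis
  \<comment> \<open>The displacement 6 \<epsilon> of p must stay below \<delta>, and \<epsilon> at
    most 1/2 for p' to exist.\<close>
  define \<epsilon> where "\<epsilon> = min (\<delta> / 12) (1 / 2)"
  have \<epsilon>: "\<epsilon> > 0" "\<epsilon> \<le> 1 / 2" "6 * \<epsilon> < \<delta>" using \<delta>(1) by (auto simp: \<epsilon>_def min_def)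
  obtain u where u: "u \<in> Proj F" "u * s = s" "norm (u * p - p) < \<epsilon>"
    using dominating_approx_unit[OF s p \<epsilon>(1)] by blast
  obtain p' where p': "p' \<in> Proj F" "u * p' = p'" "norm (p' - p) \<le> 6 * \<epsilon>" "R `` {p'} = R `` {p}"
    using nearby_subprojection[OF p ProjD(2)[OF u(1)] less_imp_le[OF u(3)] \<epsilon>(2)] by blast
  have "invertible_up_to UNIV 1 a p' q" using \<delta>(2) p' \<epsilon>(3) ProjD by force
  from invertible_up_to_enlarge[OF p'(1) q u(1) p'(2) this] p'(4) u that
  show thesis by metis
qed

section \<open>Independence of the index from the pair\<close>

text \<open>The idempotents 1 - a b and 1 - a c have the same kernel, the range of a (1 - u). Their
  ranges are those of q and q', and equal kernels or equal ranges make idempotents algebraically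
  equivalent.\<close>

lemma class_eq_if_same_left:
  assumes u: "u \<in> Proj F" and q: "q \<in> Proj F" and q': "q' \<in> Proj F"
    and inv: "invertible_up_to UNIV 1 a u q" "invertible_up_to UNIV 1 a u q'"
  shows "R `` {q} = R `` {q'}"
proof -
  note prj = ProjD(2)[OF u] ProjD(2)[OF q] ProjD(2)[OF q']
  obtain b where b: "u * b = 0" "b * q = 0" "(1 - q) * (a * b) = 1 - q" "b * a * (1 - u) = 1 - u"
    using invertible_up_to_UNIV_iff[OF prj(1,2)] inv by blast
  obtain c where c: "u * c = 0" "c * q' = 0" "(1 - q') * (a * c) = 1 - q'" "c * a * (1 - u) = 1 - u"
    using invertible_up_to_UNIV_iff[OF prj(1,3)] inv by blast
  let ?e = "1 - a * b" and ?f = "1 - a * c"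
  have abc: "a * b * (a * c) = a * c" "a * c * (a * b) = a * b"
  proof -
    have "a * b * (a * c) = a * (b * a * (1 - u)) * c" "a * c * (a * b) = a * (c * a * (1 - u)) * b"
      using b(1) c(1) by (simp_all add: algebra_simps)
    then show "a * b * (a * c) = a * c" "a * c * (a * b) = a * b"
      unfolding b(4) c(4) using b(1) c(1) by (simp_all add: algebra_simps)
  qed
  have e: "?e * q = q" "q * ?e = ?e" "?f * q' = q'" "q' * ?f = ?f"
    using b(2,3) c(2,3) by (simp_all add: algebra_simps)
  have ef: "?e * ?f = ?e" "?f * ?e = ?f" using abc by (simp_all add: algebra_simps)
  note rules = e ef e[THEN mult_assoc_eq] ef[THEN mult_assoc_eq] is_projectionD[OF prj(2)] is_projectionD[OF prj(3)]
  have "alg_equiv q q'"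
    unfolding alg_equiv_def
    by (rule exI[of _ "?f * q"], rule exI[of _ "?e * q'"]) (simp only: mult.assoc rules simp_thms)
  then show ?thesis using alg_equiv_imp_class_eq q q' by blast
qed

text \<open>Only the second pair has to be perturbed: its new first entry u lies above p, so the
  first pair can be enlarged to u directly. The new second entries are then equivalent.\<close>

lemma index_unique:
  assumes p: "p \<in> Proj F" and q: "q \<in> Proj F" and p': "p' \<in> Proj F" and q': "q' \<in> Proj F"
    and inv: "invertible_up_to UNIV 1 a p q" "invertible_up_to UNIV 1 a p' q'"
  shows "((R `` {p}, R `` {q}), (R `` {p'}, R `` {q'})) \<in> groth_rel S"
proof -
  obtain u r' where 1: "u \<in> Proj F" "r' \<in> Proj F" "u * p = p" "r' * q' = q'" "invertible_up_to UNIV 1 a u r'"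
    "R `` {u} \<otimes>\<^bsub>S\<^esub> R `` {q'} = R `` {p'} \<otimes>\<^bsub>S\<^esub> R `` {r'}"
    using invertible_up_to_dominating[OF p' q' p inv(2)] .
  obtain r where 2: "r \<in> Proj F" "r * q = q" "invertible_up_to UNIV 1 a u r"
    "R `` {u} \<otimes>\<^bsub>S\<^esub> R `` {q} = R `` {p} \<otimes>\<^bsub>S\<^esub> R `` {r}"
    using invertible_up_to_enlarge[OF p q 1(1,3) inv(1)] .
  have rr: "R `` {r'} = R `` {r}" by (rule class_eq_if_same_left[OF 1(1,2) 2(1) 1(5) 2(3)])
  note C = S_class[OF p] S_class[OF q] S_class[OF p'] S_class[OF q'] S_class[OF 1(1)] S_class[OF 2(1)]
  \<comment> \<open>Adding the two enlargement identities crosswise leaves [u] + [r] on both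
    sides.\<close>
  let ?z = "R `` {u} \<otimes>\<^bsub>S\<^esub> R `` {r}"
  have "R `` {p} \<otimes>\<^bsub>S\<^esub> R `` {q'} \<otimes>\<^bsub>S\<^esub> ?z = (R `` {p} \<otimes>\<^bsub>S\<^esub> R `` {r}) \<otimes>\<^bsub>S\<^esub> (R `` {u} \<otimes>\<^bsub>S\<^esub> R `` {q'})"
    using C by (simp add: S.m_ac)
  also have "\<dots> = (R `` {u} \<otimes>\<^bsub>S\<^esub> R `` {q}) \<otimes>\<^bsub>S\<^esub> (R `` {p'} \<otimes>\<^bsub>S\<^esub> R `` {r})"
    using 1(6) 2(4) rr by simp
  also have "\<dots> = R `` {p'} \<otimes>\<^bsub>S\<^esub> R `` {q} \<otimes>\<^bsub>S\<^esub> ?z" using C by (simp add: S.m_ac)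
  finally show ?thesis unfolding S.groth_rel_iff
    using C by (intro conjI bexI[of _ ?z]) (simp_all only: S.m_closed)
qed

lemma fredholm_index_eq:
  assumes p: "p \<in> Proj F" and q: "q \<in> Proj F" and inv: "invertible_up_to UNIV 1 a p q"
  shows "fredholm_index UNIV 1 F a = groth_rel S `` {(R `` {p}, R `` {q})}"
proof -
  have diff: "K_class UNIV F p \<otimes>\<^bsub>K_group UNIV F\<^esub> inv\<^bsub>K_group UNIV F\<^esub> K_class UNIV F q =
      groth_rel S `` {(R `` {p}, R `` {q})}" if "p \<in> Proj F" "q \<in> Proj F" for p q
    unfolding K_class_def K_group_def using that by (intro S.groth_embed_diff S_class)
  show ?thesis
    unfolding fredholm_index_def
  proof (rule the_equality)
    show "\<exists>p'\<in>Proj F. \<exists>q'\<in>Proj F. invertible_up_to UNIV 1 a p' q' \<and> groth_rel S `` {(R `` {p}, R `` {q})} =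
        K_class UNIV F p' \<otimes>\<^bsub>K_group UNIV F\<^esub> inv\<^bsub>K_group UNIV F\<^esub> K_class UNIV F q'"
      using diff[OF p q] p q inv by metis
  next
    fix k assume "\<exists>p'\<in>Proj F. \<exists>q'\<in>Proj F. invertible_up_to UNIV 1 a p' q' \<and>
      k = K_class UNIV F p' \<otimes>\<^bsub>K_group UNIV F\<^esub> inv\<^bsub>K_group UNIV F\<^esub> K_class UNIV F q'"
    then obtain p' q' where *: "p' \<in> Proj F" "q' \<in> Proj F" "invertible_up_to UNIV 1 a p' q'"
      "k = groth_rel S `` {(R `` {p'}, R `` {q'})}" using diff by metis
    then show "k = groth_rel S `` {(R `` {p}, R `` {q})}"
      using equiv_class_eq[OF S.groth_rel_equiv index_unique[OF *(1,2) p q *(3) inv]] by simp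
  qed
qed

end


section \<open>Corners\<close>

text \<open>Surjectivity of h pulls the cancelling element back to M and injectivity removes h. This
  carries uniqueness of the index over to the corner.\<close>

lemma groth_rel_iso_reflect:
  assumes "comm_monoid M" "comm_monoid N" "h \<in> iso M N"
    and c: "x \<in> carrier M" "y \<in> carrier M" "x' \<in> carrier M" "y' \<in> carrier M"
    and rel: "((h x, h y), (h x', h y')) \<in> groth_rel N"
  shows "((x, y), (x', y')) \<in> groth_rel M"
proof -
  interpret M: comm_monoid M by fact
  interpret N: comm_monoid N by fact
  have h: "h \<in> hom M N" "inj_on h (carrier M)" "h ` carrier M = carrier N"
    using assms(3) by (auto simp: iso_def bij_betw_def)
  obtain z where z: "z \<in> carrier N" "h x \<otimes>\<^bsub>N\<^esub> h y' \<otimes>\<^bsub>N\<^esub> z = h x' \<otimes>\<^bsub>N\<^esub> h y \<otimes>\<^bsub>N\<^esub> z"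
    using rel by (auto simp: N.groth_rel_iff)
  have "z \<in> h ` carrier M" using z(1) h(3) by simp
  then obtain w where w: "w \<in> carrier M" "z = h w" by (rule imageE)
  have "h (x \<otimes>\<^bsub>M\<^esub> y' \<otimes>\<^bsub>M\<^esub> w) = h (x' \<otimes>\<^bsub>M\<^esub> y \<otimes>\<^bsub>M\<^esub> w)"
    using c w z(2) by (simp add: hom_mult[OF h(1)])
  then have "x \<otimes>\<^bsub>M\<^esub> y' \<otimes>\<^bsub>M\<^esub> w = x' \<otimes>\<^bsub>M\<^esub> y \<otimes>\<^bsub>M\<^esub> w"
    using c w(1) by (intro inj_onD[OF h(2)]) simp_all
  then show ?thesis unfolding M.groth_rel_iff using c w(1) by blast
qed

section \<open>Projections of the corner and their equivalence\<close>

locale finite_type_corner = unital_finite_type F for F :: "'a::unital_cstar_algebra set" +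
  fixes e0 :: 'a
  assumes e0: "e0 \<in> Proj F"
begin

abbreviation "C \<equiv> corner (1 - e0) UNIV"
abbreviation "G \<equiv> corner (1 - e0) F"
abbreviation "S' \<equiv> proj_semigroup C G"

lemmas e0_projection = ProjD(2)[OF e0]

lemma corner_iff:
  assumes "\<And>x. x \<in> X \<Longrightarrow> (1 - e0) * x * (1 - e0) \<in> X"
  shows "x \<in> corner (1 - e0) X \<longleftrightarrow> x \<in> X \<and> e0 * x = 0 \<and> x * e0 = 0"
proof
  note E = is_projectionD[OF e0_projection]
  assume "x \<in> corner (1 - e0) X"
  then obtain y where y: "y \<in> X" "x = (1 - e0) * y * (1 - e0)" by (auto simp: corner_def)
  have "e0 * x = 0" "x * e0 = 0" unfolding y(2) by (simp_all add: algebra_simps E)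
  then show "x \<in> X \<and> e0 * x = 0 \<and> x * e0 = 0" using y assms by simp
next
  assume x: "x \<in> X \<and> e0 * x = 0 \<and> x * e0 = 0"
  then have "x = (1 - e0) * x * (1 - e0)" by (simp add: algebra_simps)
  then show "x \<in> corner (1 - e0) X" unfolding corner_def using x by blast
qed

lemma C_iff: "x \<in> C \<longleftrightarrow> e0 * x = 0 \<and> x * e0 = 0"
  using corner_iff[of UNIV x] by simp

lemma Proj_G_iff: "r \<in> Proj G \<longleftrightarrow> r \<in> Proj F \<and> e0 * r = 0"
proof -
  have "r \<in> G \<longleftrightarrow> r \<in> F \<and> e0 * r = 0 \<and> r * e0 = 0" by (rule corner_iff) (simp add: F_mult)
  then show ?thesis using projection_zero_sym[OF e0_projection] by (auto simp: Proj_def)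
qed

text \<open>A partial isometry between projections of the corner lies in the corner: v = r v and v*
  = s v* are both annihilated by \<open>e0\<close> from the left.\<close>

lemma mvn_corner_iff: "(r, s) \<in> mvn_rel C G \<longleftrightarrow> r \<in> Proj G \<and> s \<in> Proj G \<and> (r, s) \<in> R"
proof -
  have "v \<in> C" if v: "v * star v = r" "star v * v = s" and rs: "r \<in> Proj G" "s \<in> Proj G" for v
  proof -
    have r: "is_projection r" "is_projection s" "e0 * r = 0" "e0 * s = 0"
      using rs Proj_G_iff ProjD by auto
    have "e0 * v = e0 * r * v" using mvn_absorb[OF v(1) r(1)] by (simp add: mult.assoc)
    moreover have "e0 * star v = e0 * s * star v"
      using mvn_absorb[of "star v" s] v(2) r(2) by (simp add: star_star mult.assoc)
    ultimately have "e0 * v = 0" "e0 * star v = 0" using r(3,4) by simp_all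
    then show ?thesis
      using C_iff by (metis is_projectionD(2)[OF e0_projection] star_mult star_star star_zero)
  qed
  then show ?thesis by (auto simp: mvn_rel_def Proj_G_iff)
qed

lemma class_corner: "r \<in> Proj G \<Longrightarrow> mvn_class C G r = R `` {r} \<inter> Proj G"
  by (auto simp: mvn_corner_iff)

section \<open>The semigroup of the corner\<close>

lemma corner_representative:
  assumes "p \<in> Proj F"
  obtains r where "r \<in> Proj G" "R `` {r} = R `` {p}"
  using perp_rep[OF e0 assms] e0_projection Proj_G_iff ProjD proj_perp_iff by metis

lemma class_refl: "p \<in> Proj F \<Longrightarrow> p \<in> R `` {p}"
  using equiv_class_self[OF mvn_equiv] .

text \<open>Restriction to the projections of the corner is one half of the isomorphism between the
  semigroups; saturation under \<open>R\<close> is the other.\<close>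

lemma carrier_S': "carrier S' = (\<lambda>Z. Z \<inter> Proj G) ` carrier S"
proof
  show "carrier S' \<subseteq> (\<lambda>Z. Z \<inter> Proj G) ` carrier S"
    using class_corner S_class Proj_G_iff by (fastforce simp: proj_semigroup_def[of C] quotient_def)
  show "(\<lambda>Z. Z \<inter> Proj G) ` carrier S \<subseteq> carrier S'"
  proof clarify
    fix Z assume "Z \<in> carrier S"
    then obtain p where "p \<in> Proj F" "Z = R `` {p}" by (rule S_carrierE)
    then obtain r where "r \<in> Proj G" "Z = R `` {r}" using corner_representative by metis
    then show "Z \<inter> Proj G \<in> carrier S'"
      using class_corner by (auto simp: proj_semigroup_def[of C] quotient_def)
  qed
qed

lemma saturate_restrict:
  assumes "Z \<in> carrier S"
  shows "R `` (Z \<inter> Proj G) = Z"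
proof -
  obtain p where "p \<in> Proj F" "Z = R `` {p}" using S_carrierE[OF assms] .
  then obtain r where r: "r \<in> Proj G" "Z = R `` {r}" using corner_representative by metis
  then have "r \<in> Z \<inter> Proj G" using class_refl Proj_G_iff by blast
  then show ?thesis using r(2) mvn_equiv by (blast elim: equivE dest: transD)
qed

text \<open>All orthogonal representatives in the corner give the restricted class of the sum, by
  \<open>S_mult\<close>; the rest of the proof exhibits one such pair, so that the union is not
  empty.\<close>

lemma mult_S':
  assumes "Z \<in> carrier S" "W \<in> carrier S"
  shows "(Z \<inter> Proj G) \<otimes>\<^bsub>S'\<^esub> (W \<inter> Proj G) = (Z \<otimes>\<^bsub>S\<^esub> W) \<inter> Proj G"
proof -
  have sum: "mvn_class C G (r + s) = (Z \<otimes>\<^bsub>S\<^esub> W) \<inter> Proj G"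
    if "r \<in> Z \<inter> Proj G" "s \<in> W \<inter> Proj G" "proj_perp r s" for r s
  proof -
    have *: "r \<in> Proj F" "s \<in> Proj F" "r + s \<in> Proj G"
      using that Proj_G_iff Proj_add by (auto simp: distrib_left)
    have "Z = R `` {r}" "W = R `` {s}"
      using assms that equiv_class_eq[OF mvn_equiv] by (auto elim!: S_carrierE)
    then show ?thesis using S_mult[OF *(1,2) that(3)] class_corner[OF *(3)] by simp
  qed
  obtain p where "p \<in> Proj F" "Z = R `` {p}" using S_carrierE[OF assms(1)] .
  then obtain r where r: "r \<in> Proj G" "Z = R `` {r}" using corner_representative by metis
  then have rF: "r \<in> Proj F" "e0 * r = 0" using Proj_G_iff by auto
  then have e0r: "e0 + r \<in> Proj F" using e0 Proj_add proj_perp_iff ProjD by metis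
  obtain q where q: "q \<in> Proj F" "W = R `` {q}" using S_carrierE[OF assms(2)] .
  \<comment> \<open>Orthogonality to \<open>e0 + r\<close> puts s into the corner and makes it
    orthogonal to r at the same time.\<close>
  obtain s where s: "s \<in> Proj F" "proj_perp (e0 + r) s" "W = R `` {s}"
    using perp_rep[OF e0r q(1)] q(2) by metis
  have 0: "(e0 + r) * s = 0" using s e0r proj_perp_iff ProjD by blast
  have "e0 * s = e0 * ((e0 + r) * s)" "r * s = r * ((e0 + r) * s)"
    using rF projection_zero_sym[OF e0_projection ProjD(2)[OF rF(1)]]
      is_projectionD[OF e0_projection] is_projectionD[OF ProjD(2)[OF rF(1)]]
    by (simp_all add: distrib_left distrib_right mult.assoc[symmetric])
  then have "e0 * s = 0" "r * s = 0" using 0 by simp_all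
  then have "s \<in> W \<inter> Proj G" "proj_perp r s" "r \<in> Z \<inter> Proj G"
    using s r rF proj_perp_iff ProjD class_refl Proj_G_iff by blast+
  then have "{mvn_class C G (r + s) |r s. r \<in> Z \<inter> Proj G \<and> s \<in> W \<inter> Proj G \<and> proj_perp r s}
      = {(Z \<otimes>\<^bsub>S\<^esub> W) \<inter> Proj G}"
    using sum by (intro equalityI subsetI) (simp_all, metis+)
  then show ?thesis by (simp add: proj_semigroup_def[of C])
qed

lemma one_S': "\<one>\<^bsub>S'\<^esub> = \<one>\<^bsub>S\<^esub> \<inter> Proj G"
proof -
  have "0 \<in> Proj F" by (simp add: Proj_def zero_F is_projection_def star_zero)
  then have "0 \<in> Proj G" by (simp add: Proj_G_iff)
  then show ?thesis using class_corner by (simp add: proj_semigroup_def)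
qed

text \<open>The monoid laws are those of \<open>S\<close>, carried over by restriction.\<close>

lemma comm_monoid_S': "comm_monoid S'"
proof (rule comm_monoidI)
  show "\<one>\<^bsub>S'\<^esub> \<in> carrier S'" using S.one_closed by (simp add: one_S' carrier_S')
qed (auto simp: carrier_S' mult_S' one_S' S.m_ac)

lemma saturate_iso: "(\<lambda>X. R `` X) \<in> iso S' S"
proof (rule isoI)
  show "(\<lambda>X. R `` X) \<in> hom S' S"
    by (rule homI) (clarsimp simp: carrier_S' mult_S' saturate_restrict)+
  show "bij_betw (\<lambda>X. R `` X) (carrier S') (carrier S)"
    by (rule bij_betw_byWitness[where f' = "\<lambda>Z. Z \<inter> Proj G"]) (auto simp: carrier_S' saturate_restrict)
qed

lemma class_corner_carrier:
  assumes "r \<in> Proj G"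
  shows "mvn_class C G r \<in> carrier S'" "R `` mvn_class C G r = R `` {r}"
  using assms class_corner saturate_restrict S_class Proj_G_iff by (auto simp: carrier_S')

section \<open>Pairs in the corner and pairs above \<open>e0\<close>\<close>

lemma Proj_G_plus:
  assumes "r \<in> Proj G"
  shows "e0 + r \<in> Proj F" "R `` {e0 + r} = R `` {e0} \<otimes>\<^bsub>S\<^esub> R `` {r}"
proof -
  have r: "r \<in> Proj F" "proj_perp e0 r" using assms Proj_G_iff proj_perp_iff e0 ProjD by blast+
  show "e0 + r \<in> Proj F" "R `` {e0 + r} = R `` {e0} \<otimes>\<^bsub>S\<^esub> R `` {r}"
    using Proj_add[OF e0 r] S_mult[OF e0 r] by simp_all
qed

lemma Proj_G_minus:
  assumes "u \<in> Proj F" "u * e0 = e0"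
  shows "u - e0 \<in> Proj G"
proof -
  have "e0 * u = e0" using assms projection_le_sym e0_projection ProjD by blast
  then show ?thesis
    using Proj_diff[OF e0 assms] is_projectionD[OF e0_projection] by (simp add: Proj_G_iff algebra_simps)
qed

text \<open>The projection \<open>1 - e0 - p\<close> is 1 - (e0 + p) and absorbs
  \<open>1 - e0\<close>, so both sides compress a to the same element; the shape required of b
  places it in the corner.\<close>

lemma invertible_up_to_corner_iff:
  assumes p: "p \<in> Proj G" and q: "q \<in> Proj G"
  shows "invertible_up_to C (1 - e0) ((1 - e0) * a * (1 - e0)) p q \<longleftrightarrow> invertible_up_to UNIV 1 a (e0 + p) (e0 + q)"
proof -
  note E = is_projectionD[OF e0_projection]
  have 0: "e0 * p = 0" "e0 * q = 0" using p q Proj_G_iff by auto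
  then have 1: "p * e0 = 0" "q * e0 = 0"
    using p q Proj_G_iff projection_zero_sym e0_projection ProjD by blast+
  have "(1 - e0 - q) * ((1 - e0) * a * (1 - e0)) * (1 - e0 - p) = (1 - e0 - q) * a * (1 - e0 - p)"
  proof -
    have "(1 - e0 - q) * (1 - e0) = 1 - e0 - q" "(1 - e0) * (1 - e0 - p) = 1 - e0 - p"
      using 0 1 by (simp_all add: algebra_simps E)
    then show ?thesis by (metis mult.assoc)
  qed
  moreover have "(1 - e0 - p) * b * (1 - e0 - q) \<in> C" for b
    unfolding C_iff using 0 1 by (simp add: algebra_simps E mult_assoc_eq[OF 0(1)])
  ultimately show ?thesis
    unfolding invertible_up_to_def Let_def diff_diff_eq[symmetric] by (metis UNIV_I)
qed

lemma index_corner_unique: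
  assumes pq: "p \<in> Proj G" "q \<in> Proj G" "p' \<in> Proj G" "q' \<in> Proj G"
    and inv: "invertible_up_to UNIV 1 a (e0 + p) (e0 + q)" "invertible_up_to UNIV 1 a (e0 + p') (e0 + q')"
  shows "((mvn_class C G p, mvn_class C G q), (mvn_class C G p', mvn_class C G q')) \<in> groth_rel S'"
proof -
  have c: "R `` {e0} \<in> carrier S" "R `` {p} \<in> carrier S" "R `` {q} \<in> carrier S"
    "R `` {p'} \<in> carrier S" "R `` {q'} \<in> carrier S"
    using pq e0 S_class Proj_G_iff by auto
  obtain z where z: "z \<in> carrier S"
    "(R `` {e0} \<otimes>\<^bsub>S\<^esub> R `` {p}) \<otimes>\<^bsub>S\<^esub> (R `` {e0} \<otimes>\<^bsub>S\<^esub> R `` {q'}) \<otimes>\<^bsub>S\<^esub> z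
     = (R `` {e0} \<otimes>\<^bsub>S\<^esub> R `` {p'}) \<otimes>\<^bsub>S\<^esub> (R `` {e0} \<otimes>\<^bsub>S\<^esub> R `` {q}) \<otimes>\<^bsub>S\<^esub> z"
    using index_unique[OF _ _ _ _ inv] pq by (auto simp: Proj_G_plus S.groth_rel_iff)
  \<comment> \<open>The two copies of [e0] on each side move into the cancelling element.\<close>
  let ?z = "R `` {e0} \<otimes>\<^bsub>S\<^esub> R `` {e0} \<otimes>\<^bsub>S\<^esub> z"
  have "R `` {p} \<otimes>\<^bsub>S\<^esub> R `` {q'} \<otimes>\<^bsub>S\<^esub> ?z = R `` {p'} \<otimes>\<^bsub>S\<^esub> R `` {q} \<otimes>\<^bsub>S\<^esub> ?z"
    using z c by (simp add: S.m_ac)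
  moreover have "?z \<in> carrier S" using z c by simp
  ultimately have "((R `` {p}, R `` {q}), (R `` {p'}, R `` {q'})) \<in> groth_rel S"
    unfolding S.groth_rel_iff using c by blast
  then show ?thesis
    by (intro groth_rel_iso_reflect[OF comm_monoid_S' S.comm_monoid_axioms saturate_iso])
      (simp_all add: class_corner_carrier pq)
qed

lemma fredholm_index_corner_eq:
  assumes p: "p \<in> Proj G" and q: "q \<in> Proj G" and inv: "invertible_up_to UNIV 1 a (e0 + p) (e0 + q)"
  shows "fredholm_index C (1 - e0) G ((1 - e0) * a * (1 - e0)) = groth_rel S' `` {(mvn_class C G p, mvn_class C G q)}"
    (is "fredholm_index C _ G ?a = _")
proof -
  interpret S': comm_monoid S' by (rule comm_monoid_S')
  have diff: "K_class C G p \<otimes>\<^bsub>K_group C G\<^esub> inv\<^bsub>K_group C G\<^esub> K_class C G q =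
      groth_rel S' `` {(mvn_class C G p, mvn_class C G q)}" if "p \<in> Proj G" "q \<in> Proj G" for p q
    unfolding K_class_def K_group_def using that by (intro S'.groth_embed_diff class_corner_carrier)
  show ?thesis
    unfolding fredholm_index_def
  proof (rule the_equality)
    show "\<exists>p'\<in>Proj G. \<exists>q'\<in>Proj G. invertible_up_to C (1 - e0) ?a p' q' \<and>
        groth_rel S' `` {(mvn_class C G p, mvn_class C G q)} =
        K_class C G p' \<otimes>\<^bsub>K_group C G\<^esub> inv\<^bsub>K_group C G\<^esub> K_class C G q'"
      using diff[OF p q] p q inv invertible_up_to_corner_iff by metis
  next
    fix k assume "\<exists>p'\<in>Proj G. \<exists>q'\<in>Proj G. invertible_up_to C (1 - e0) ?a p' q' \<and>
      k = K_class C G p' \<otimes>\<^bsub>K_group C G\<^esub> inv\<^bsub>K_group C G\<^esub> K_class C G q'"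
    then obtain p' q' where *: "p' \<in> Proj G" "q' \<in> Proj G" "invertible_up_to UNIV 1 a (e0 + p') (e0 + q')"
      "k = groth_rel S' `` {(mvn_class C G p', mvn_class C G q')}"
      using diff invertible_up_to_corner_iff by metis
    then show "k = groth_rel S' `` {(mvn_class C G p, mvn_class C G q)}"
      using equiv_class_eq[OF S'.groth_rel_equiv index_corner_unique[OF *(1,2) p q *(3) inv]] by simp
  qed
qed

text \<open>A first pass puts \<open>e0\<close> below the first entry, a second pass for the adjoint
  below the other. The second pass only enlarges u to u', so the first gain is kept.\<close>

lemma fredholm_corner_iff:
  "fredholm_type UNIV 1 F a \<longleftrightarrow> (\<exists>p\<in>Proj G. \<exists>q\<in>Proj G. invertible_up_to UNIV 1 a (e0 + p) (e0 + q))"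
proof
  assume "fredholm_type UNIV 1 F a"
  then obtain p q where pq: "p \<in> Proj F" "q \<in> Proj F" "invertible_up_to UNIV 1 a p q"
    by (auto simp: fredholm_type_def)
  obtain u q' where 1: "u \<in> Proj F" "q' \<in> Proj F" "u * e0 = e0" "q' * q = q" "invertible_up_to UNIV 1 a u q'"
    "R `` {u} \<otimes>\<^bsub>S\<^esub> R `` {q} = R `` {p} \<otimes>\<^bsub>S\<^esub> R `` {q'}"
    using invertible_up_to_dominating[OF pq(1,2) e0 pq(3)] .
  have star: "invertible_up_to UNIV 1 (star a) q' u" using invertible_up_to_star 1 ProjD by blast
  obtain v u' where 2: "v \<in> Proj F" "u' \<in> Proj F" "v * e0 = e0" "u' * u = u" "invertible_up_to UNIV 1 (star a) v u'"
    "R `` {v} \<otimes>\<^bsub>S\<^esub> R `` {u} = R `` {q'} \<otimes>\<^bsub>S\<^esub> R `` {u'}"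
    using invertible_up_to_dominating[OF 1(2,1) e0 star] .
  have "invertible_up_to UNIV 1 a u' v" using invertible_up_to_star[OF _ _ 2(5)] 2(1,2) ProjD by (simp add: star_star)
  moreover have "u' * e0 = e0" using 1(3) 2(4) by (metis mult.assoc)
  ultimately show "\<exists>p\<in>Proj G. \<exists>q\<in>Proj G. invertible_up_to UNIV 1 a (e0 + p) (e0 + q)"
    using 2(1,2,3) Proj_G_minus by (intro bexI[of _ "u' - e0"] bexI[of _ "v - e0"]) simp_all
qed (use Proj_G_plus in \<open>auto simp: fredholm_type_def\<close>)

lemma fredholm_index_corner:
  assumes "fredholm_type UNIV 1 F a"
  shows "fredholm_index UNIV 1 F a = K_inclusion UNIV F (fredholm_index C (1 - e0) G ((1 - e0) * a * (1 - e0)))"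
proof -
  obtain p q where pq: "p \<in> Proj G" "q \<in> Proj G" and inv: "invertible_up_to UNIV 1 a (e0 + p) (e0 + q)"
    using assms fredholm_corner_iff by blast
  have c: "R `` {e0} \<in> carrier S" "R `` {p} \<in> carrier S" "R `` {q} \<in> carrier S"
    using pq e0 S_class Proj_G_iff by auto
  have hom: "(\<lambda>X. R `` X) \<in> hom S' S" using saturate_iso by (simp add: iso_def)
  have "K_inclusion UNIV F (fredholm_index C (1 - e0) G ((1 - e0) * a * (1 - e0))) = groth_rel S `` {(R `` {p}, R `` {q})}"
    unfolding K_inclusion_def fredholm_index_corner_eq[OF pq inv]
      groth_map_class[OF comm_monoid_S' S.comm_monoid_axioms hom class_corner_carrier(1)[OF pq(1)] class_corner_carrier(1)[OF pq(2)]]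
    by (simp only: class_corner_carrier(2) pq)
  \<comment> \<open>Adding [e0] to both entries leaves their difference unchanged.\<close>
  also have "\<dots> = groth_rel S `` {(R `` {e0 + p}, R `` {e0 + q})}"
    using c by (intro equiv_class_eq[OF S.groth_rel_equiv])
      (auto simp: S.groth_rel_iff Proj_G_plus[OF pq(1)] Proj_G_plus[OF pq(2)] S.m_ac intro!: bexI[of _ "\<one>\<^bsub>S\<^esub>"])
  also have "\<dots> = fredholm_index UNIV 1 F a"
    using fredholm_index_eq[OF Proj_G_plus(1)[OF pq(1)] Proj_G_plus(1)[OF pq(2)] inv] by simp
  finally show ?thesis by simp
qed

end

theorem corollary3p7:
  fixes F :: "'a::unital_cstar_algebra set" and a p :: 'a
  assumes "finite_type_ideal UNIV F"
    and "p \<in> Proj F"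
  shows "(fredholm_type UNIV 1 F a \<longleftrightarrow>
          fredholm_type (corner (1 - p) UNIV) (1 - p) (corner (1 - p) F) ((1 - p) * a * (1 - p))) \<and>
         (fredholm_type UNIV 1 F a \<longrightarrow>
          fredholm_index UNIV 1 F a =
          K_inclusion UNIV F
            (fredholm_index (corner (1 - p) UNIV) (1 - p) (corner (1 - p) F) ((1 - p) * a * (1 - p))))"
proof -
  interpret finite_type_corner F p by unfold_locales (use assms in auto)
  show ?thesis
    using fredholm_corner_iff[of a] fredholm_index_corner[of a] invertible_up_to_corner_iff[of _ _ a]
    by (auto simp: fredholm_type_def[of "corner (1 - p) UNIV"])
qed

end
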